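(* Let $q\in\mathbb C^*$ be not a root of unity, and let $V$ be a simple $\mathbb C_q[SL_2]$-module on which $x_{12}$ and $x_{21}$ do not both act as zero (i.e. $V$ is not of type $(e,e)$). Suppose that $V$ is semisimple as a module over the commutative subalgebra $\langle x_{12},x_{21}\rangle\subset\mathbb C_q[SL_2]$. Then $V$ is isomorphic to one of the typical modules $M^-(\gamma)$ ($\gamma\in\mathbb C^*$), $M^+(\eta)$ ($\eta\in\mathbb C^*$), $M(\gamma,\eta)$ ($\gamma,\eta\in\mathbb C^*$ with $\gamma\eta\neq-q^{2k+1}$ for all $k\in\mathbb Z$), $M^h(\eta)$ ($\eta\in\mathbb C^*$), $M^l(\gamma)$ ($\gamma\in\mathbb C^*$).
   Context: $\mathbb C_q[SL_2]$ is the $\mathbb C$-algebra generated by $x_{11},x_{12},x_{21},x_{22}$ with relations $x_{11}x_{12}=qx_{12}x_{11}$, $x_{11}x_{21}=qx_{21}x_{11}$, $x_{12}x_{22}=qx_{22}x_{12}$, $x_{21}x_{22}=qx_{22}x_{21}$, $x_{12}x_{21}=x_{21}x_{12}$, $x_{11}x_{22}-x_{22}x_{11}=(q-q^{-1})x_{12}x_{21}$, $x_{11}x_{22}-qx_{12}x_{21}=1$. Its primitive ideals are of four types: $(e,e)$: $(x_{12},x_{21},x_{11}-\gamma,x_{22}-\gamma^{-1})$; $(s,e)$: $(x_{12})$; $(e,s)$: $(x_{21})$; $(s,s)$: $(x_{12}-\gamma x_{21})$ ($\gamma\in\mathbb C^*$). Simple modules of type $(e,e)$ are one-dimensional. The typical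 modules are the following. $M^-(\gamma)$: basis $e_i$, $i\in\mathbb Z$; $x_{11}e_i=e_{i-1}$, $x_{22}e_i=e_{i+1}$, $x_{12}e_i=0$, $x_{21}e_i=\gamma q^ie_i$. $M^+(\eta)$: basis $e_i$, $i\in\mathbb Z$; $x_{11}e_i=e_{i-1}$, $x_{22}e_i=e_{i+1}$, $x_{12}e_i=\eta q^ie_i$, $x_{21}e_i=0$. $M(\gamma,\eta)$: basis $e_i$, $i\in\mathbb Z$; $x_{11}e_i=(1+\gamma\eta q^{2i-1})e_{i-1}$, $x_{22}e_i=e_{i+1}$, $x_{12}e_i=\eta q^ie_i$, $x_{21}e_i=\gamma q^ie_i$. $M^h(\eta)$: basis $e_i$, $i\in\mathbb Z_{\ge0}$; $x_{11}e_i=(1-q^{2i})e_{i-1}$ (so $x_{11}e_0=0$), $x_{22}e_i=e_{i+1}$, $x_{12}e_i=\eta q^ie_i$, $x_{21}e_i=-\eta^{-1}q^{i+1}e_i$. $M^l(\gamma)$: basis $e_i$, $i\in\mathbb Z_{\le0}$; $x_{11}e_i=e_{i-1}$, $x_{22}e_i=(1-q^{2i})e_{i+1}$ (so $x_{22}e_0=0$), $x_{12}e_i=\gamma q^ie_i$, $x_{21}e_i=-\gamma^{-1}q^{i-1}e_i$. *)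

theory Defs
  imports
    Complex_Main
    "HOL-Library.Poly_Mapping"
    "HOL-Algebra.QuotRing"
    "HOL-Algebra.Generated_Rings"
begin

section \<open>Left modules over a not necessarily commutative ring\<close>

text \<open>
  The library locale \<open>module\<close> requires a commutative ring. The record \<open>module\<close> and the locale
  \<open>submodule\<close> (a subgroup of the additive group closed under the action) do not, and are reused.
\<close>

locale left_module = R?: ring R + M?: abelian_group M
  for R :: "('a, 'm) ring_scheme" (structure) and M :: "('a, 'b, 'n) module_scheme" (structure) +
  assumes smult_closed:
      "\<lbrakk>a \<in> carrier R; x \<in> carrier M\<rbrakk> \<Longrightarrow> a \<odot>\<^bsub>M\<^esub> x \<in> carrier M"
    and smult_l_distr:
      "\<lbrakk>a \<in> carrier R; b \<in> carrier R; x \<in> carrier M\<rbrakk> \<Longrightarrow>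
       (a \<oplus>\<^bsub>R\<^esub> b) \<odot>\<^bsub>M\<^esub> x = a \<odot>\<^bsub>M\<^esub> x \<oplus>\<^bsub>M\<^esub> b \<odot>\<^bsub>M\<^esub> x"
    and smult_r_distr:
      "\<lbrakk>a \<in> carrier R; x \<in> carrier M; y \<in> carrier M\<rbrakk> \<Longrightarrow>
       a \<odot>\<^bsub>M\<^esub> (x \<oplus>\<^bsub>M\<^esub> y) = a \<odot>\<^bsub>M\<^esub> x \<oplus>\<^bsub>M\<^esub> a \<odot>\<^bsub>M\<^esub> y"
    and smult_assoc:
      "\<lbrakk>a \<in> carrier R; b \<in> carrier R; x \<in> carrier M\<rbrakk> \<Longrightarrow>
       (a \<otimes>\<^bsub>R\<^esub> b) \<odot>\<^bsub>M\<^esub> x = a \<odot>\<^bsub>M\<^esub> (b \<odot>\<^bsub>M\<^esub> x)"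
    and smult_one:
      "x \<in> carrier M \<Longrightarrow> \<one>\<^bsub>R\<^esub> \<odot>\<^bsub>M\<^esub> x = x"

definition simple_module ::
    "('a, 'm) ring_scheme \<Rightarrow> ('a, 'b, 'n) module_scheme \<Rightarrow> bool" where
  "simple_module R M \<longleftrightarrow>
     left_module R M \<and> carrier M \<noteq> {\<zero>\<^bsub>M\<^esub>} \<and>
     (\<forall>N. submodule N R M \<longrightarrow> N = {\<zero>\<^bsub>M\<^esub>} \<or> N = carrier M)"

definition simple_submodule ::
    "'b set \<Rightarrow> ('a, 'm) ring_scheme \<Rightarrow> ('a, 'b, 'n) module_scheme \<Rightarrow> bool" where
  "simple_submodule S R M \<longleftrightarrow> submodule S R M \<and> simple_module R (M\<lparr>carrier := S\<rparr>)"

text \<open>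
  A module is semisimple if it is the direct sum of a family of simple submodules; the sum of a
  family of submodules is the additive subgroup generated by its union.
\<close>

definition semisimple_module ::
    "('a, 'm) ring_scheme \<Rightarrow> ('a, 'b, 'n) module_scheme \<Rightarrow> bool" where
  "semisimple_module R M \<longleftrightarrow>
     left_module R M \<and>
     (\<exists>F. (\<forall>S\<in>F. simple_submodule S R M) \<and>
          generate (add_monoid M) (\<Union>F) = carrier M \<and>
          (\<forall>S\<in>F. S \<inter> generate (add_monoid M) (\<Union>(F - {S})) = {\<zero>\<^bsub>M\<^esub>}))"

definition module_iso ::
    "('a, 'm) ring_scheme \<Rightarrow> ('a, 'b, 'n) module_scheme \<Rightarrow> ('a, 'c, 'k) module_scheme \<Rightarrow> bool"
  where
  "module_iso R M N \<longleftrightarrow>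
     (\<exists>f. bij_betw f (carrier M) (carrier N) \<and>
          (\<forall>x\<in>carrier M. \<forall>y\<in>carrier M. f (x \<oplus>\<^bsub>M\<^esub> y) = f x \<oplus>\<^bsub>N\<^esub> f y) \<and>
          (\<forall>a\<in>carrier R. \<forall>x\<in>carrier M. f (a \<odot>\<^bsub>M\<^esub> x) = a \<odot>\<^bsub>N\<^esub> f x))"


section \<open>The algebra $C_q[SL_2]$\<close>

datatype gen = X11 | X12 | X21 | X22

text \<open>
  Words in the generators, with concatenation written additively so that the convolution product
  of \<^theory>\<open>HOL-Library.Poly_Mapping\<close> makes finitely supported functions on words the free
  algebra.
\<close>

datatype word = Word (letters: "gen list")

instantiation word :: monoid_add
begin
definition "0 = Word []"
definition "v + w = Word (letters v @ letters w)"
instance by standard (auto simp: zero_word_def plus_word_def)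
end

type_synonym free = "word \<Rightarrow>\<^sub>0 complex"

definition free_algebra :: "free ring" where
  "free_algebra = \<lparr>carrier = UNIV, mult = (*), one = 1, zero = 0, add = (+)\<rparr>"

definition free_gen :: "gen \<Rightarrow> free" where
  "free_gen g = Poly_Mapping.single (Word [g]) 1"

definition free_const :: "complex \<Rightarrow> free" where
  "free_const c = Poly_Mapping.single 0 c"

definition sl2_relations :: "complex \<Rightarrow> free set" where
  "sl2_relations q =
     (let x11 = free_gen X11; x12 = free_gen X12; x21 = free_gen X21; x22 = free_gen X22;
          k = free_const
      in {x11 * x12 - k q * x12 * x11,
          x11 * x21 - k q * x21 * x11,
          x12 * x22 - k q * x22 * x12,
          x21 * x22 - k q * x22 * x21,
          x12 * x21 - x21 * x12,
          x11 * x22 - x22 * x11 - k (q - inverse q) * x12 * x21,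
          x11 * x22 - k q * x12 * x21 - 1})"

definition sl2_ideal :: "complex \<Rightarrow> free set" where
  "sl2_ideal q = genideal free_algebra (sl2_relations q)"

definition Cq_SL2 :: "complex \<Rightarrow> free set ring" where
  "Cq_SL2 q = free_algebra Quot sl2_ideal q"

definition Cq_class :: "complex \<Rightarrow> free \<Rightarrow> free set" where
  "Cq_class q p = sl2_ideal q +>\<^bsub>free_algebra\<^esub> p"

definition Cq_gen :: "complex \<Rightarrow> gen \<Rightarrow> free set" where
  "Cq_gen q g = Cq_class q (free_gen g)"

text \<open>
  Modules over the algebra \<open>Cq_SL2 q\<close> are modules over the underlying ring: the complex scalars
  act through the classes of the constants. Hence a subalgebra is a subring containing those
  classes.
\<close>

definition Cq_subalgebra :: "complex \<Rightarrow> gen set \<Rightarrow> free set set" where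
  "Cq_subalgebra q G =
     generate_ring (Cq_SL2 q) (range (\<lambda>c. Cq_class q (free_const c)) \<union> Cq_gen q ` G)"


section \<open>The typical modules\<close>

text \<open>
  All typical modules have a basis \<open>e i\<close> (\<open>i \<in> I\<close>, where \<open>I\<close> is a set of integers) on which the
  generators act by \<open>x e i = c x i * e (i + gen_shift x)\<close>. The basis vector \<open>e i\<close> is
  \<open>Poly_Mapping.single i 1\<close>.
\<close>

fun gen_shift :: "gen \<Rightarrow> int" where
  "gen_shift X11 = -1"
| "gen_shift X12 = 0"
| "gen_shift X21 = 0"
| "gen_shift X22 = 1"

definition gen_action ::
    "(gen \<Rightarrow> int \<Rightarrow> complex) \<Rightarrow> gen \<Rightarrow> (int \<Rightarrow>\<^sub>0 complex) \<Rightarrow> (int \<Rightarrow>\<^sub>0 complex)" where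
  "gen_action c g v =
     (\<Sum>i\<in>Poly_Mapping.keys v.
        Poly_Mapping.single (i + gen_shift g) (c g i * Poly_Mapping.lookup v i))"

definition free_action ::
    "(gen \<Rightarrow> int \<Rightarrow> complex) \<Rightarrow> free \<Rightarrow> (int \<Rightarrow>\<^sub>0 complex) \<Rightarrow> (int \<Rightarrow>\<^sub>0 complex)" where
  "free_action c p v =
     (\<Sum>w\<in>Poly_Mapping.keys p.
        Poly_Mapping.map ((*) (Poly_Mapping.lookup p w)) (foldr (gen_action c) (letters w) v))"

text \<open>
  An element of \<open>Cq_SL2 q\<close> acts by any of its representatives in the free algebra; the choice is
  immaterial when \<open>c\<close> is compatible with the relations, see \<open>typical_module_smult\<close> below. The
  fields \<open>mult\<close> and \<open>one\<close> of the record have no meaning for a module.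
\<close>

definition typical_module ::
    "int set \<Rightarrow> (gen \<Rightarrow> int \<Rightarrow> complex) \<Rightarrow> (free set, int \<Rightarrow>\<^sub>0 complex) module" where
  "typical_module I c =
     \<lparr>carrier = {v. Poly_Mapping.keys v \<subseteq> I}, mult = undefined, one = undefined,
      zero = 0, add = (+), smult = (\<lambda>a v. free_action c (SOME p. p \<in> a) v)\<rparr>"

definition coeff_minus :: "complex \<Rightarrow> complex \<Rightarrow> gen \<Rightarrow> int \<Rightarrow> complex" where
  "coeff_minus q \<gamma> g i =
     (case g of X11 \<Rightarrow> 1 | X12 \<Rightarrow> 0 | X21 \<Rightarrow> \<gamma> * q powi i | X22 \<Rightarrow> 1)"

definition coeff_plus :: "complex \<Rightarrow> complex \<Rightarrow> gen \<Rightarrow> int \<Rightarrow> complex" where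
  "coeff_plus q \<eta> g i =
     (case g of X11 \<Rightarrow> 1 | X12 \<Rightarrow> \<eta> * q powi i | X21 \<Rightarrow> 0 | X22 \<Rightarrow> 1)"

definition coeff_full :: "complex \<Rightarrow> complex \<Rightarrow> complex \<Rightarrow> gen \<Rightarrow> int \<Rightarrow> complex" where
  "coeff_full q \<gamma> \<eta> g i =
     (case g of X11 \<Rightarrow> 1 + \<gamma> * \<eta> * q powi (2 * i - 1) | X12 \<Rightarrow> \<eta> * q powi i
              | X21 \<Rightarrow> \<gamma> * q powi i | X22 \<Rightarrow> 1)"

definition coeff_h :: "complex \<Rightarrow> complex \<Rightarrow> gen \<Rightarrow> int \<Rightarrow> complex" where
  "coeff_h q \<eta> g i =
     (case g of X11 \<Rightarrow> 1 - q powi (2 * i) | X12 \<Rightarrow> \<eta> * q powi i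
              | X21 \<Rightarrow> - inverse \<eta> * q powi (i + 1) | X22 \<Rightarrow> 1)"

definition coeff_l :: "complex \<Rightarrow> complex \<Rightarrow> gen \<Rightarrow> int \<Rightarrow> complex" where
  "coeff_l q \<gamma> g i =
     (case g of X11 \<Rightarrow> 1 | X12 \<Rightarrow> \<gamma> * q powi i
              | X21 \<Rightarrow> - inverse \<gamma> * q powi (i - 1) | X22 \<Rightarrow> 1 - q powi (2 * i))"

definition "M_minus q \<gamma> = typical_module UNIV (coeff_minus q \<gamma>)"
definition "M_plus q \<eta> = typical_module UNIV (coeff_plus q \<eta>)"
definition "M_full q \<gamma> \<eta> = typical_module UNIV (coeff_full q \<gamma> \<eta>)"
definition "M_h q \<eta> = typical_module {0..} (coeff_h q \<eta>)"
definition "M_l q \<gamma> = typical_module {..0} (coeff_l q \<gamma>)"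


section \<open>The definitions are meaningful\<close>

lemma ring_free_algebra: "ring free_algebra"
proof (rule ringI)
  show "abelian_group free_algebra"
    by (rule abelian_groupI)
       (auto simp: free_algebra_def add.assoc add.commute intro: exI right_minus)
  show "Group.monoid free_algebra"
    by (rule monoidI) (auto simp: free_algebra_def mult.assoc)
qed (auto simp: free_algebra_def distrib_left distrib_right)

lemma ideal_sl2_ideal: "ideal (sl2_ideal q) free_algebra"
  unfolding sl2_ideal_def
  by (rule ring.genideal_ideal[OF ring_free_algebra]) (simp add: free_algebra_def)

lemma ring_Cq_SL2: "ring (Cq_SL2 q)"
  unfolding Cq_SL2_def by (rule ideal.quotient_is_ring[OF ideal_sl2_ideal])

lemma carrier_Cq_SL2: "carrier (Cq_SL2 q) = range (Cq_class q)"
  by (auto simp: Cq_SL2_def Cq_class_def FactRing_def A_RCOSETS_def RCOSETS_def a_r_coset_def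
        free_algebra_def)

lemma Cq_class_simps:
  "Cq_class q p \<oplus>\<^bsub>Cq_SL2 q\<^esub> Cq_class q r = Cq_class q (p + r)"
  "Cq_class q p \<otimes>\<^bsub>Cq_SL2 q\<^esub> Cq_class q r = Cq_class q (p * r)"
  "\<one>\<^bsub>Cq_SL2 q\<^esub> = Cq_class q 1"
proof -
  note h = ideal.rcos_ring_hom[OF ideal_sl2_ideal[of q], unfolded ring_hom_def]
  show "Cq_class q p \<oplus>\<^bsub>Cq_SL2 q\<^esub> Cq_class q r = Cq_class q (p + r)"
    "Cq_class q p \<otimes>\<^bsub>Cq_SL2 q\<^esub> Cq_class q r = Cq_class q (p * r)"
    "\<one>\<^bsub>Cq_SL2 q\<^esub> = Cq_class q 1"
    using h by (auto simp: Cq_SL2_def Cq_class_def free_algebra_def)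
qed

lemma Cq_class_memD: "r \<in> Cq_class q p \<Longrightarrow> r - p \<in> sl2_ideal q"
  by (auto simp: Cq_class_def a_r_coset_def r_coset_def free_algebra_def)

lemma Cq_class_self: "p \<in> Cq_class q p"
  using ring.ring_simprules(2)[OF ring_free_algebra]
    additive_subgroup.zero_closed[OF ideal.axioms(1)[OF ideal_sl2_ideal[of q]]]
  by (force simp: Cq_class_def a_r_coset_def r_coset_def free_algebra_def)

lemma lookup_gen_action:
  "Poly_Mapping.lookup (gen_action c g v) j
     = c g (j - gen_shift g) * Poly_Mapping.lookup v (j - gen_shift g)"
proof -
  have "Poly_Mapping.lookup (gen_action c g v) j
      = (\<Sum>i\<in>Poly_Mapping.keys v.
           if i = j - gen_shift g then c g i * Poly_Mapping.lookup v i else 0)"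
    unfolding gen_action_def lookup_sum
    by (rule sum.cong) (auto simp: lookup_single when_def)
  also have "\<dots> = c g (j - gen_shift g) * Poly_Mapping.lookup v (j - gen_shift g)"
    by (rule trans[OF sum.delta[OF finite_keys]]) (simp add: in_keys_iff)
  finally show ?thesis .
qed

lemma lookup_scale:
  "Poly_Mapping.lookup (Poly_Mapping.map ((*) (a::complex)) v) j = a * Poly_Mapping.lookup v j"
  by (simp add: Poly_Mapping.map.rep_eq when_def)

lemma lookup_free_action_superset:
  assumes "finite A" "Poly_Mapping.keys p \<subseteq> A"
  shows "Poly_Mapping.lookup (free_action c p v) j
     = (\<Sum>w\<in>A. Poly_Mapping.lookup p w
               * Poly_Mapping.lookup (foldr (gen_action c) (letters w) v) j)"
  unfolding free_action_def lookup_sum lookup_scale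
  by (rule sum.mono_neutral_left) (use assms in \<open>auto simp: in_keys_iff\<close>)

lemma free_action_add: "free_action c (p + r) v = free_action c p v + free_action c r v"
proof (rule poly_mapping_eqI)
  fix j
  let ?A = "Poly_Mapping.keys p \<union> Poly_Mapping.keys r"
  have "Poly_Mapping.keys (p + r) \<subseteq> ?A" by (rule Poly_Mapping.keys_add)
  then show "Poly_Mapping.lookup (free_action c (p + r) v) j
      = Poly_Mapping.lookup (free_action c p v + free_action c r v) j"
    by (simp add: lookup_add lookup_free_action_superset[of ?A] distrib_right sum.distrib)
qed

lemma free_action_single:
  "free_action c (Poly_Mapping.single w a) v
     = Poly_Mapping.map ((*) a) (foldr (gen_action c) (letters w) v)"
  by (rule poly_mapping_eqI)
     (simp add: lookup_free_action_superset[of "{w}"] lookup_scale)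

lemma gen_action_linear:
  "gen_action c g (v + w) = gen_action c g v + gen_action c g w"
  "gen_action c g (Poly_Mapping.map ((*) a) v) = Poly_Mapping.map ((*) a) (gen_action c g v)"
  by (rule poly_mapping_eqI; simp add: lookup_gen_action lookup_add lookup_scale algebra_simps)+

lemma foldr_gen_action_linear:
  "foldr (gen_action c) l (v + w) = foldr (gen_action c) l v + foldr (gen_action c) l w"
  "foldr (gen_action c) l (Poly_Mapping.map ((*) a) v)
     = Poly_Mapping.map ((*) a) (foldr (gen_action c) l v)"
  by (induction l) (simp_all add: gen_action_linear)

lemma scale_add:
  "Poly_Mapping.map ((*) (a::complex)) (v + w) = Poly_Mapping.map ((*) a) v + Poly_Mapping.map ((*) a) w"
  by (rule poly_mapping_eqI) (simp add: lookup_scale lookup_add algebra_simps)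

lemma free_action_add_right: "free_action c p (v + w) = free_action c p v + free_action c p w"
  by (simp add: free_action_def foldr_gen_action_linear scale_add sum.distrib)

lemma free_induct [case_names zero add]:
  assumes "P 0" and "\<And>w a (p::free). P p \<Longrightarrow> P (Poly_Mapping.single w a + p)"
  shows "P p"
proof (induction p rule: update_induct)
  case const
  show ?case by fact
next
  case (update f a b)
  have "Poly_Mapping.update a b f = Poly_Mapping.single a b + f"
    using update(1)
    by (intro poly_mapping_eqI) (auto simp: lookup_update lookup_add lookup_single when_def in_keys_iff)
  with assms(2) update show ?case by metis
qed

lemma free_action_zero: "free_action c 0 v = 0" "free_action c p 0 = 0"
  using free_action_add[of c 0 0 v] free_action_add_right[of c p 0 0] by auto

lemma free_action_mult: "free_action c (p * r) v = free_action c p (free_action c r v)"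
proof (induction p rule: free_induct)
  case zero
  show ?case by (simp add: free_action_zero)
next
  case (add w a p)
  have "free_action c (Poly_Mapping.single w a * r) v
      = free_action c (Poly_Mapping.single w a) (free_action c r v)"
  proof (induction r rule: free_induct)
    case zero
    show ?case by (simp add: free_action_zero)
  next
    case (add u b r)
    have "free_action c (Poly_Mapping.single w a * Poly_Mapping.single u b) v
        = free_action c (Poly_Mapping.single w a) (free_action c (Poly_Mapping.single u b) v)"
      by (rule poly_mapping_eqI)
         (simp add: mult_single free_action_single plus_word_def foldr_gen_action_linear lookup_scale)
    with add show ?case
      by (simp add: distrib_left free_action_add free_action_add_right)
  qed
  with add show ?case
    by (simp add: distrib_right free_action_add)
qed

lemma free_action_one: "free_action c 1 v = v"
  unfolding single_one[symmetric] free_action_single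
  by (rule poly_mapping_eqI) (simp add: zero_word_def lookup_scale)

lemma free_action_diff: "free_action c (p - r) v = free_action c p v - free_action c r v"
  using free_action_add[of c "p - r" r v] by (simp add: algebra_simps)

lemma free_action_gen: "free_action c (free_gen g) v = gen_action c g v"
  by (rule poly_mapping_eqI) (simp add: free_gen_def free_action_single lookup_scale)

lemma free_action_const: "free_action c (free_const a) v = Poly_Mapping.map ((*) a) v"
  by (simp add: free_const_def free_action_single zero_word_def)

definition compatible :: "complex \<Rightarrow> int set \<Rightarrow> (gen \<Rightarrow> int \<Rightarrow> complex) \<Rightarrow> bool" where
  "compatible q I c \<longleftrightarrow>
     (\<forall>p\<in>sl2_relations q. \<forall>v. free_action c p v = 0) \<and>
     (\<forall>g. \<forall>i\<in>I. i + gen_shift g \<notin> I \<longrightarrow> c g i = 0)"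

lemma compatible_sl2_ideal:
  assumes "compatible q I c" "p \<in> sl2_ideal q"
  shows "free_action c p v = 0"
proof -
  let ?K = "{p. \<forall>v. free_action c p v = 0}"
  have neg: "free_action c (- p) v = - free_action c p v" for p v
    using free_action_diff[of c 0 p v] by (simp add: free_action_zero)
  have minus: "\<ominus>\<^bsub>free_algebra\<^esub> p = - p" for p
    using ring.ring_simprules(9)[OF ring_free_algebra, of p]
      abelian_group.minus_equality[OF ring.is_abelian_group[OF ring_free_algebra], of "- p" p]
    by (simp add: free_algebra_def)
  have "ideal ?K free_algebra"
  proof (rule idealI[OF ring_free_algebra])
    show "subgroup ?K (add_monoid free_algebra)"
    proof (rule group.subgroupI)
      show "Group.group (add_monoid free_algebra)"
        by (rule abelian_group.a_group[OF ring.is_abelian_group[OF ring_free_algebra]])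
    next
      have "0 \<in> ?K" by (simp add: free_action_zero)
      then show "?K \<noteq> {}" by blast
    next
      fix a assume "a \<in> ?K"
      then show "inv\<^bsub>add_monoid free_algebra\<^esub> a \<in> ?K"
        using minus[of a] by (simp add: a_inv_def neg)
    qed (auto simp: free_algebra_def free_action_add)
  qed (auto simp: free_algebra_def free_action_mult free_action_zero)
  moreover have "sl2_relations q \<subseteq> ?K" using assms(1) by (auto simp: compatible_def)
  ultimately have "sl2_ideal q \<subseteq> ?K"
    unfolding sl2_ideal_def by (rule ring.genideal_minimal[OF ring_free_algebra])
  with assms(2) show ?thesis by blast
qed

lemma typical_module_smult:
  assumes "compatible q I c"
  shows "Cq_class q p \<odot>\<^bsub>typical_module I c\<^esub> v = free_action c p v"
proof -
  have "(SOME r. r \<in> Cq_class q p) \<in> Cq_class q p"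
    using Cq_class_self by (rule someI)
  from Cq_class_memD[OF this] compatible_sl2_ideal[OF assms]
  have "free_action c ((SOME r. r \<in> Cq_class q p) - p) v = 0" by blast
  then show ?thesis by (simp add: typical_module_def free_action_diff)
qed

lemma free_action_closed:
  assumes "compatible q I c" "Poly_Mapping.keys v \<subseteq> I"
  shows "Poly_Mapping.keys (free_action c p v) \<subseteq> I"
proof -
  have g: "Poly_Mapping.keys (gen_action c g u) \<subseteq> I" if "Poly_Mapping.keys u \<subseteq> I" for g u
  proof
    fix j assume "j \<in> Poly_Mapping.keys (gen_action c g u)"
    then have 1: "c g (j - gen_shift g) \<noteq> 0" "j - gen_shift g \<in> Poly_Mapping.keys u"
      by (auto simp: in_keys_iff lookup_gen_action)
    then have "j - gen_shift g \<in> I" using that by blast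
    then have "j - gen_shift g + gen_shift g \<notin> I \<longrightarrow> c g (j - gen_shift g) = 0"
      using assms(1) unfolding compatible_def by blast
    with 1(1) show "j \<in> I" by simp
  qed
  have f: "Poly_Mapping.keys (foldr (gen_action c) l v) \<subseteq> I" for l
    by (induction l) (use assms(2) g in auto)
  show ?thesis
  proof
    fix j assume "j \<in> Poly_Mapping.keys (free_action c p v)"
    then have "(\<Sum>w\<in>Poly_Mapping.keys p. Poly_Mapping.lookup p w
               * Poly_Mapping.lookup (foldr (gen_action c) (letters w) v) j) \<noteq> 0"
      by (simp add: in_keys_iff lookup_free_action_superset[of "Poly_Mapping.keys p"])
    then obtain w where "Poly_Mapping.lookup (foldr (gen_action c) (letters w) v) j \<noteq> 0"
      by (rule sum.not_neutral_contains_not_neutral) auto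
    then show "j \<in> I" using subsetD[OF f, of j "letters w"] by (simp add: in_keys_iff)
  qed
qed

lemma left_module_typical_module:
  assumes "compatible q I c"
  shows "left_module (Cq_SL2 q) (typical_module I c)"
proof (intro left_module.intro left_module_axioms.intro ring_Cq_SL2)
  show "abelian_group (typical_module I c)"
  proof (rule abelian_groupI)
    fix x assume x: "x \<in> carrier (typical_module I c)"
    then have "- x \<in> carrier (typical_module I c)"
      by (auto simp: typical_module_def in_keys_iff)
    then show "\<exists>y\<in>carrier (typical_module I c).
        y \<oplus>\<^bsub>typical_module I c\<^esub> x = \<zero>\<^bsub>typical_module I c\<^esub>"
      by (rule bexI[rotated]) (simp add: typical_module_def)
  next
    fix x y assume "x \<in> carrier (typical_module I c)" "y \<in> carrier (typical_module I c)"
    then show "x \<oplus>\<^bsub>typical_module I c\<^esub> y \<in> carrier (typical_module I c)"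
      using Poly_Mapping.keys_add[of x y] by (auto simp: typical_module_def)
  qed (simp_all add: typical_module_def add_ac)
next
  let ?M = "typical_module I c"
  fix a b x y
  assume "a \<in> carrier (Cq_SL2 q)" "x \<in> carrier ?M"
  then obtain p where a: "a = Cq_class q p" and x: "Poly_Mapping.keys x \<subseteq> I"
    by (auto simp: carrier_Cq_SL2 typical_module_def)
  show "a \<odot>\<^bsub>?M\<^esub> x \<in> carrier ?M"
    using free_action_closed[OF assms x]
    by (simp add: a typical_module_smult[OF assms]) (simp add: typical_module_def)
  have M: "u \<oplus>\<^bsub>?M\<^esub> v = u + v" for u v by (simp add: typical_module_def)
  show "a \<odot>\<^bsub>?M\<^esub> (x \<oplus>\<^bsub>?M\<^esub> y) = a \<odot>\<^bsub>?M\<^esub> x \<oplus>\<^bsub>?M\<^esub> a \<odot>\<^bsub>?M\<^esub> y"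
    by (simp add: a M typical_module_smult[OF assms] free_action_add_right)
  assume "b \<in> carrier (Cq_SL2 q)"
  then obtain r where b: "b = Cq_class q r" by (auto simp: carrier_Cq_SL2)
  show "(a \<oplus>\<^bsub>Cq_SL2 q\<^esub> b) \<odot>\<^bsub>?M\<^esub> x = a \<odot>\<^bsub>?M\<^esub> x \<oplus>\<^bsub>?M\<^esub> b \<odot>\<^bsub>?M\<^esub> x"
    by (simp add: a b M Cq_class_simps typical_module_smult[OF assms] free_action_add)
  show "(a \<otimes>\<^bsub>Cq_SL2 q\<^esub> b) \<odot>\<^bsub>?M\<^esub> x = a \<odot>\<^bsub>?M\<^esub> (b \<odot>\<^bsub>?M\<^esub> x)"
    by (simp add: a b Cq_class_simps typical_module_smult[OF assms] free_action_mult)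
next
  fix x
  show "\<one>\<^bsub>Cq_SL2 q\<^esub> \<odot>\<^bsub>typical_module I c\<^esub> x = x"
    by (simp add: Cq_class_simps typical_module_smult[OF assms] free_action_one)
qed

lemma typical_module_basis:
  assumes "compatible q I c"
  shows "Cq_gen q g \<odot>\<^bsub>typical_module I c\<^esub> Poly_Mapping.single i 1
           = Poly_Mapping.single (i + gen_shift g) (c g i)"
  unfolding Cq_gen_def typical_module_smult[OF assms] free_action_gen
  by (rule poly_mapping_eqI) (auto simp: lookup_gen_action lookup_single when_def)

lemma compatibleI:
  assumes r1: "\<And>i. c X11 i * c X12 i = q * (c X11 i * c X12 (i - 1))"
    and r2: "\<And>i. c X11 i * c X21 i = q * (c X11 i * c X21 (i - 1))"
    and r3: "\<And>i. c X22 i * c X12 (i + 1) = q * (c X22 i * c X12 i)"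
    and r4: "\<And>i. c X22 i * c X21 (i + 1) = q * (c X22 i * c X21 i)"
    and r6: "\<And>i. c X22 i * c X11 (i + 1) - c X11 i * c X22 (i - 1)
                   = (q - inverse q) * (c X12 i * c X21 i)"
    and r7: "\<And>i. c X22 i * c X11 (i + 1) - q * (c X12 i * c X21 i) = 1"
    and bdry: "\<And>g i. i \<in> I \<Longrightarrow> i + gen_shift g \<notin> I \<Longrightarrow> c g i = 0"
  shows "compatible q I c"
proof -
  note acts = free_action_diff free_action_mult free_action_gen free_action_const free_action_one
  note looks = lookup_minus lookup_gen_action lookup_scale
  have "free_action c p v = 0" if "p \<in> sl2_relations q" for p v
  proof (rule poly_mapping_eqI)
    fix j
    let ?v = "Poly_Mapping.lookup v"
    note h = that[unfolded sl2_relations_def Let_def]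
    show "Poly_Mapping.lookup (free_action c p v) j = Poly_Mapping.lookup 0 j"
      using h arg_cong[OF r1[of "j + 1"], of "\<lambda>t. t * ?v (j + 1)"]
        arg_cong[OF r2[of "j + 1"], of "\<lambda>t. t * ?v (j + 1)"]
        arg_cong[OF r3[of "j - 1"], of "\<lambda>t. t * ?v (j - 1)"]
        arg_cong[OF r4[of "j - 1"], of "\<lambda>t. t * ?v (j - 1)"]
        arg_cong[OF r6[of j], of "\<lambda>t. t * ?v j"]
        arg_cong[OF r7[of j], of "\<lambda>t. t * ?v j"]
      by (elim insertE emptyE; hypsubst; unfold acts looks gen_shift.simps)
         (auto simp: algebra_simps)
  qed
  with bdry show ?thesis unfolding compatible_def by blast
qed

lemmas coeff_defs = coeff_minus_def coeff_plus_def coeff_full_def coeff_h_def coeff_l_def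

lemma compatible_typical:
  assumes q: "q \<noteq> 0"
  shows "compatible q UNIV (coeff_minus q \<gamma>)"
    and "compatible q UNIV (coeff_plus q \<eta>)"
    and "compatible q UNIV (coeff_full q \<gamma> \<eta>)"
    and "\<eta> \<noteq> 0 \<Longrightarrow> compatible q {0..} (coeff_h q \<eta>)"
    and "\<gamma> \<noteq> 0 \<Longrightarrow> compatible q {..0} (coeff_l q \<gamma>)"
proof -
  have dbl: "q powi (2 * j) = q powi j * q powi j" for j :: int
    using q by (simp only: mult_2 power_int_add simp_thms)
  have e: "q powi (j + 1) = q powi j * q" "q powi (j - 1) = q powi j / q" for j :: int
    using q by (simp_all add: power_int_add power_int_diff)
  have d: "q powi (2 * j + 1) = q powi j * q powi j * q"
    "q powi (2 * j - 1) = q powi j * q powi j / q"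
    "q powi (2 * (j + 1)) = q powi j * q powi j * q * q"
    "q powi (2 * (j + 1) - 1) = q powi j * q powi j * q"
    "q powi (2 * (j - 1)) = q powi j * q powi j / q / q" for j :: int
    by (simp_all only: e dbl) (simp_all add: q)
  have d': "q powi (1 + 2 * j) = q powi j * q powi j * q"
    "q powi (1 + j * 2) = q powi j * q powi j * q" "q powi (j * 2) = q powi j * q powi j"
    for j :: int
    using d(1)[of j] dbl[of j] by (simp_all only: add.commute mult.commute[of 2])
  have f: "q powi (j + 2) = q powi j * q * q" "q powi (j - 2) = q powi j / q / q"
    "q powi (2 * j + 2) = q powi j * q powi j * q * q"
    "q powi (2 * j - 2) = q powi j * q powi j / q / q" for j :: int
    using q by (simp_all only: power_int_add power_int_diff dbl simp_thms)
      (simp_all add: power2_eq_square)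
  have b_h: "coeff_h q \<eta> g i = 0" if "i \<in> {0..}" "i + gen_shift g \<notin> {0..}" for g i
  proof (cases "i = 0")
    case True
    with that show ?thesis by (cases g) (simp_all add: coeff_h_def)
  next
    case False
    with that show ?thesis by (cases g) simp_all
  qed
  have b_l: "coeff_l q \<gamma> g i = 0" if "i \<in> {..0}" "i + gen_shift g \<notin> {..0}" for g i
  proof (cases "i = 0")
    case True
    with that show ?thesis by (cases g) (simp_all add: coeff_l_def)
  next
    case False
    with that show ?thesis by (cases g) simp_all
  qed
  show "compatible q UNIV (coeff_minus q \<gamma>)"
    by (rule compatibleI) (simp_all add: coeff_defs e d q)
  show "compatible q UNIV (coeff_plus q \<eta>)"
    by (rule compatibleI) (simp_all add: coeff_defs e d q)
  show "compatible q UNIV (coeff_full q \<gamma> \<eta>)"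
    by (rule compatibleI) (simp_all add: coeff_defs e d d' dbl q, (simp add: q d' dbl field_simps)+)
  show "compatible q {0..} (coeff_h q \<eta>)" if "\<eta> \<noteq> 0"
    by (rule compatibleI; (rule b_h; assumption)?)
      (simp_all add: coeff_defs e d d' f dbl q that, (simp add: q that d' f dbl field_simps)+)
  show "compatible q {..0} (coeff_l q \<gamma>)" if "\<gamma> \<noteq> 0"
    by (rule compatibleI; (rule b_l; assumption)?)
      (simp_all add: coeff_defs e d d' f dbl q that, (simp add: q that d' f dbl field_simps)+)
qed

end

theory Submission
  imports Defs "HOL-Analysis.Continuum_Not_Denumerable"
    "HOL-Computational_Algebra.Fundamental_Theorem_Algebra"
begin

text \<open>
  A simple summand \<open>S\<close> of the restriction of \<open>V\<close> to the commutative subalgebra has countable dimension,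
  so by Dixmier's argument \<open>x\<^sub>1\<^sub>2\<close> and \<open>x\<^sub>2\<^sub>1\<close> act on it by scalars \<open>\<eta>\<close> and \<open>\<gamma>\<close>, and any nonzero
  \<open>v \<in> S\<close> is a common eigenvector. The relations make \<open>x\<^sub>2\<^sub>2\<close> and \<open>x\<^sub>1\<^sub>1\<close> multiply both eigenvalues by \<open>q\<close>
  and \<open>q\<^sup>-\<^sup>1\<close>, while \<open>x\<^sub>1\<^sub>1 x\<^sub>2\<^sub>2\<close> and \<open>x\<^sub>2\<^sub>2 x\<^sub>1\<^sub>1\<close> act on \<open>v\<close> by \<open>1 + q \<eta> \<gamma>\<close> and \<open>1 + q\<^sup>-\<^sup>1 \<eta> \<gamma>\<close>. If these
  scalars never vanish along the orbit of \<open>v\<close>, the orbit is indexed by all integers. Otherwise the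
  weight of \<open>v\<close> can be moved to \<open>\<eta> \<gamma> = - q\<close> or \<open>\<eta> \<gamma> = - q\<^sup>-\<^sup>1\<close>, where one further step either
  gives zero or a vector annihilated by the opposite generator, and the orbit is a half line.
  Distinct weights are linearly independent because \<open>q\<close> is not a root of unity, and the orbit spans
  \<open>V\<close> by simplicity.
\<close>

section \<open>Linear dependence in a space of countable dimension\<close>

text \<open>Gaussian elimination, one coordinate per induction step: a vector \<open>g d\<close>
  with nonzero coordinate \<open>k\<close> clears that coordinate from the others and is then set
  aside. As there are more vectors than coordinates, a relation is left at the end.\<close>

lemma exists_linear_relation:
  fixes g :: "'c \<Rightarrow> 'k \<Rightarrow> 'a::field"
  assumes "finite K" "finite F" "card K < card F"
  shows "\<exists>u. (\<exists>d\<in>F. u d \<noteq> 0) \<and> (\<forall>k\<in>K. (\<Sum>c\<in>F. u c * g c k) = 0)"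
  using assms
proof (induction K arbitrary: F g rule: finite_induct)
  case empty
  then have "F \<noteq> {}" by auto
  then show ?case by (intro exI[of _ "\<lambda>_. 1"]) auto
next
  case (insert k K)
  show ?case
  proof (cases "\<forall>c\<in>F. g c k = 0")
    case True
    from insert.IH[of F g] insert.prems insert.hyps obtain u where
      "\<exists>d\<in>F. u d \<noteq> 0" "\<forall>k\<in>K. (\<Sum>c\<in>F. u c * g c k) = 0" by auto
    with True show ?thesis by (intro exI[of _ u]) auto
  next
    case False
    then obtain d where d: "d \<in> F" "g d k \<noteq> 0" by blast
    define F' where "F' = F - {d}"
    have F: "F = insert d F'" "d \<notin> F'" "finite F'"
      using d insert.prems by (auto simp: F'_def)
    define h where "h = (\<lambda>c j. g c j - g c k / g d k * g d j)"
    have "card K < card F'" using insert.prems insert.hyps F by simp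
    from insert.IH[OF F(3) this, of h] obtain u where u: "\<exists>e\<in>F'. u e \<noteq> 0"
      "\<And>j. j \<in> K \<Longrightarrow> (\<Sum>c\<in>F'. u c * h c j) = 0" by blast
    \<comment> \<open>This coefficient at the pivot \<open>d\<close> turns a relation among the
      cleared vectors \<open>h c\<close> into one among the \<open>g c\<close>.\<close>
    define s where "s = (\<Sum>c\<in>F'. u c * (g c k / g d k))"
    define w where "w = u(d := - s)"
    have w: "(\<Sum>c\<in>F. w c * g c j) = (\<Sum>c\<in>F'. u c * h c j)" for j
    proof -
      have "(\<Sum>c\<in>F. w c * g c j) = - s * g d j + (\<Sum>c\<in>F'. u c * g c j)"
        using F by (auto simp: w_def intro!: sum.cong)
      then show ?thesis
        by (simp add: s_def h_def algebra_simps sum_subtractf sum_distrib_left)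
    qed
    have "(\<Sum>c\<in>F. w c * g c j) = 0" if "j \<in> insert k K" for j
    proof (cases "j = k")
      case True
      then show ?thesis using d(2) by (simp add: w h_def)
    next
      case False
      then show ?thesis using that u(2) by (simp add: w)
    qed
    moreover have "\<exists>e\<in>F. w e \<noteq> 0" using u(1) F by (auto simp: w_def)
    ultimately show ?thesis by blast
  qed
qed

lemma inj_letters: "inj letters"
  by (metis injI word.expand)

text \<open>Number the countably many words by \<open>e\<close>, and let \<open>n c\<close> bound
  the numbers of the words occurring in \<open>f c\<close>. Uncountably many indices share countably
  many bounds, so some bound \<open>m\<close> serves infinitely many \<open>c\<close>; any
  \<open>m + 1\<close> of these give elements of a space of dimension at most
  \<open>m\<close>.\<close>

lemma uncountable_family_dependent:
  fixes f :: "complex \<Rightarrow> free"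
  shows "\<exists>F u. finite F \<and> (\<exists>d\<in>F. u d \<noteq> 0) \<and> (\<Sum>c\<in>F. free_const (u c) * f c) = 0"
proof -
  have "countable (UNIV :: gen list set)"
  proof -
    have "(UNIV :: gen set) = {X11, X12, X21, X22}" using gen.exhaust by blast
    then have "countable (UNIV :: gen set)" by (metis countable_finite finite.emptyI finite_insert)
    then show ?thesis using countable_lists[of UNIV] by simp
  qed
  then obtain e :: "gen list \<Rightarrow> nat" where "inj e" by (metis countableE)
  then have ie: "inj (e \<circ> letters)" using inj_letters by (simp add: inj_compose)
  define n where "n = (\<lambda>c. Suc (Max (insert 0 ((e \<circ> letters) ` Poly_Mapping.keys (f c)))))"
  have n: "(e \<circ> letters) w < n c" if "w \<in> Poly_Mapping.keys (f c)" for w c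
    unfolding n_def less_Suc_eq_le using that by (intro Max_ge) auto
  have "\<exists>m. infinite {c. n c = m}"
  proof (rule ccontr)
    assume "\<not> ?thesis"
    then have "countable (\<Union>m. {c. n c = m})"
      by (intro countable_UN) (auto intro: countable_finite)
    moreover have "(\<Union>m. {c. n c = m}) = UNIV" by auto
    ultimately have "countable (UNIV :: complex set)" by simp
    then show False using uncountable_UNIV_complex by blast
  qed
  then obtain m where "infinite {c. n c = m}" by blast
  then obtain F where F: "finite F" "card F = Suc m" "F \<subseteq> {c. n c = m}"
    using infinite_arbitrarily_large by blast
  define K where "K = {w. (e \<circ> letters) w < m}"
  have K: "finite K" "card K \<le> m"
  proof -
    have *: "K = (e \<circ> letters) -` {..<m}" by (auto simp: K_def)
    show "finite K" unfolding * by (rule finite_vimageI[OF _ ie]) simp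
    show "card K \<le> m" using card_vimage_inj_on_le[OF ie, of "{..<m}"] unfolding * by simp
  qed
  from exists_linear_relation[OF K(1) F(1), of "\<lambda>c. Poly_Mapping.lookup (f c)"] K(2) F(2)
  obtain u where u: "\<exists>d\<in>F. u d \<noteq> 0"
    "\<And>w. w \<in> K \<Longrightarrow> (\<Sum>c\<in>F. u c * Poly_Mapping.lookup (f c) w) = 0" by auto
  have l: "Poly_Mapping.lookup (free_const a * p) w = a * Poly_Mapping.lookup p w" for a p w
    by (simp add: free_const_def lookup_scale flip: mult_map_scale_conv_mult)
  have "(\<Sum>c\<in>F. free_const (u c) * f c) = 0"
  proof (rule poly_mapping_eqI)
    fix w
    have "(\<Sum>c\<in>F. u c * Poly_Mapping.lookup (f c) w) = 0"
    proof (cases "w \<in> K")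
      case False
      then have "Poly_Mapping.lookup (f c) w = 0" if "c \<in> F" for c
        using n[of w c] that F(3) by (fastforce simp: K_def in_keys_iff)
      then show ?thesis by simp
    qed (rule u(2))
    then show "Poly_Mapping.lookup (\<Sum>c\<in>F. free_const (u c) * f c) w = Poly_Mapping.lookup 0 w"
      by (simp add: lookup_sum l)
  qed
  with F(1) u(1) show ?thesis by blast
qed

section \<open>Complex polynomials evaluated in the free algebra\<close>

lemma free_const_simps:
  "free_const 0 = 0" "free_const 1 = 1" "free_const (a + b) = free_const a + free_const b"
  "free_const (a - b) = free_const a - free_const b" "free_const (- a) = - free_const a"
  "free_const (a * b) = free_const a * free_const b"
  by (simp_all add: free_const_def single_add single_diff single_uminus mult_single)

lemma free_const_commute: "p * free_const a = free_const a * p"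
proof (induction p rule: free_induct)
  case (add w b p)
  then show ?case
    by (simp add: distrib_left distrib_right free_const_def mult_single mult.commute)
qed simp

text \<open>Horner evaluation at the single element \<open>t\<close>. It is multiplicative although
  the free algebra is not commutative, because the coefficients enter as central constants.\<close>

definition free_eval :: "free \<Rightarrow> complex poly \<Rightarrow> free" where
  "free_eval t p = fold_coeffs (\<lambda>a r. free_const a + t * r) p 0"

lemma free_eval_0 [simp]: "free_eval t 0 = 0"
  by (simp add: free_eval_def)

lemma free_eval_pCons [simp]: "free_eval t (pCons a p) = free_const a + t * free_eval t p"
  by (cases "p = 0"; cases "a = 0") (simp_all add: free_eval_def free_const_simps)

lemma free_eval_add: "free_eval t (p + r) = free_eval t p + free_eval t r"
  by (induction p r rule: poly_induct2) (simp_all add: free_const_simps algebra_simps)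

lemma free_eval_smult: "free_eval t (smult a p) = free_const a * free_eval t p"
  by (induction p)
     (simp_all add: free_const_simps distrib_left free_const_commute[of t] flip: mult.assoc)

lemma free_eval_mult: "free_eval t (p * r) = free_eval t p * free_eval t r"
  by (induction p)
     (simp_all add: free_eval_add free_eval_smult distrib_right mult.assoc free_const_simps)

lemma free_eval_sum: "free_eval t (\<Sum>i\<in>A. p i) = (\<Sum>i\<in>A. free_eval t (p i))"
  by (induction A rule: infinite_finite_induct) (simp_all add: free_eval_add)

section \<open>The free algebra acting on a module\<close>

lemma Cq_class_eqI:
  assumes "p - r \<in> sl2_ideal q"
  shows "Cq_class q p = Cq_class q r"
proof -
  interpret I: ideal "sl2_ideal q" free_algebra by (rule ideal_sl2_ideal)
  have "p \<in> Cq_class q r"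
    using assms by (force simp: Cq_class_def a_r_coset_def r_coset_def free_algebra_def)
  then show ?thesis
    unfolding Cq_class_def
    using I.a_repr_independence[OF _ _ I.a_subgroup] by (simp add: free_algebra_def)
qed

lemma sl2_relations_subset: "sl2_relations q \<subseteq> sl2_ideal q"
  unfolding sl2_ideal_def
  by (rule ring.genideal_self[OF ring_free_algebra]) (simp add: free_algebra_def)

locale Cq_module =
  fixes q :: complex and V :: "(free set, 'v) module"
  assumes left_module: "left_module (Cq_SL2 q) V"
begin

sublocale abelian_group V
  using left_module by (simp add: left_module_def)

text \<open>Representatives act instead of classes, so computations in the module become
  computations in the free algebra; the defining relations appear as equalities between
  actions.\<close>

definition act :: "free \<Rightarrow> 'v \<Rightarrow> 'v" (infixr \<open>\<rhd>\<close> 60) where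
  "p \<rhd> v = Cq_class q p \<odot>\<^bsub>V\<^esub> v"

lemma Cq_class_carrier: "Cq_class q p \<in> carrier (Cq_SL2 q)"
  by (simp add: carrier_Cq_SL2)

lemma act_closed [simp, intro]: "v \<in> carrier V \<Longrightarrow> p \<rhd> v \<in> carrier V"
  unfolding act_def by (rule left_module.smult_closed[OF left_module Cq_class_carrier])

lemma act_add: "v \<in> carrier V \<Longrightarrow> p + r \<rhd> v = (p \<rhd> v) \<oplus>\<^bsub>V\<^esub> (r \<rhd> v)"
  using left_module.smult_l_distr[OF left_module Cq_class_carrier Cq_class_carrier]
  by (simp add: act_def Cq_class_simps)

lemma act_add_right:
  "v \<in> carrier V \<Longrightarrow> w \<in> carrier V \<Longrightarrow> p \<rhd> v \<oplus>\<^bsub>V\<^esub> w = (p \<rhd> v) \<oplus>\<^bsub>V\<^esub> (p \<rhd> w)"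
  using left_module.smult_r_distr[OF left_module Cq_class_carrier] by (simp add: act_def)

lemma act_mult: "v \<in> carrier V \<Longrightarrow> p * r \<rhd> v = p \<rhd> r \<rhd> v"
  using left_module.smult_assoc[OF left_module Cq_class_carrier Cq_class_carrier]
  by (simp add: act_def Cq_class_simps)

lemma act_one [simp]: "v \<in> carrier V \<Longrightarrow> 1 \<rhd> v = v"
  using left_module.smult_one[OF left_module] by (simp add: act_def Cq_class_simps)

lemma act_zero [simp]: "v \<in> carrier V \<Longrightarrow> 0 \<rhd> v = \<zero>\<^bsub>V\<^esub>"
  using act_add[of v 0 0] add.l_cancel_one by (metis act_closed add_0)

lemma act_zero_right [simp]: "p \<rhd> \<zero>\<^bsub>V\<^esub> = \<zero>\<^bsub>V\<^esub>"
  by (metis act_mult act_zero mult_zero_right zero_closed)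

lemma act_uminus: "v \<in> carrier V \<Longrightarrow> - p \<rhd> v = \<ominus>\<^bsub>V\<^esub> (p \<rhd> v)"
  using act_add[of v "- p" p] minus_equality by (metis act_closed act_zero left_minus)

lemma act_eq_iff: "v \<in> carrier V \<Longrightarrow> p \<rhd> v = r \<rhd> v \<longleftrightarrow> p - r \<rhd> v = \<zero>\<^bsub>V\<^esub>"
  using act_add[of v p "- r"]
  by (auto simp: act_uminus r_neg)
     (metis act_closed a_inv_closed minus_equality minus_minus)

lemma act_diff_cong:
  "v \<in> carrier V \<Longrightarrow> p \<rhd> v = p' \<rhd> v \<Longrightarrow> r \<rhd> v = r' \<rhd> v \<Longrightarrow> p - r \<rhd> v = p' - r' \<rhd> v"
  using act_add[of v p "- r"] act_add[of v p' "- r'"] by (simp add: act_uminus)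

lemma act_sum_cong:
  assumes "v \<in> carrier V" "\<And>i. i \<in> A \<Longrightarrow> P i \<rhd> v = Q i \<rhd> v"
  shows "(\<Sum>i\<in>A. P i) \<rhd> v = (\<Sum>i\<in>A. Q i) \<rhd> v"
  using assms(2) by (induction A rule: infinite_finite_induct) (simp_all add: act_add assms(1))

lemma act_cong_ideal: "p - r \<in> sl2_ideal q \<Longrightarrow> p \<rhd> v = r \<rhd> v"
  by (simp add: act_def Cq_class_eqI)

lemma act_relations:
  "free_gen X11 * free_gen X12 \<rhd> v = free_const q * free_gen X12 * free_gen X11 \<rhd> v"
  "free_gen X11 * free_gen X21 \<rhd> v = free_const q * free_gen X21 * free_gen X11 \<rhd> v"
  "free_gen X12 * free_gen X22 \<rhd> v = free_const q * free_gen X22 * free_gen X12 \<rhd> v"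
  "free_gen X21 * free_gen X22 \<rhd> v = free_const q * free_gen X22 * free_gen X21 \<rhd> v"
  "free_gen X12 * free_gen X21 \<rhd> v = free_gen X21 * free_gen X12 \<rhd> v"
  "free_gen X11 * free_gen X22 - free_gen X22 * free_gen X11 \<rhd> v
     = free_const (q - inverse q) * free_gen X12 * free_gen X21 \<rhd> v"
  "free_gen X11 * free_gen X22 - free_const q * free_gen X12 * free_gen X21 \<rhd> v = 1 \<rhd> v"
  by (rule act_cong_ideal, rule subsetD[OF sl2_relations_subset],
      simp add: sl2_relations_def Let_def)+

section \<open>Schur's lemma by Dixmier's countability argument\<close>

text \<open>By the fundamental theorem of algebra \<open>p\<close> splits into a nonzero constant
  and linear factors. Each factor \<open>t - z\<close> is injective on \<open>S\<close>, and they
  are cancelled one at a time.\<close>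

lemma free_eval_eq_zeroD:
  assumes inj: "\<And>z w. w \<in> S \<Longrightarrow> t - free_const z \<rhd> w = \<zero>\<^bsub>V\<^esub> \<Longrightarrow> w = \<zero>\<^bsub>V\<^esub>"
    and S: "S \<subseteq> carrier V" "\<And>p w. w \<in> S \<Longrightarrow> free_eval t p \<rhd> w \<in> S"
    and v: "v \<in> S" "free_eval t p \<rhd> v = \<zero>\<^bsub>V\<^esub>" and "p \<noteq> 0"
  shows "v = \<zero>\<^bsub>V\<^esub>"
  using v(2) \<open>p \<noteq> 0\<close>
proof (induction "degree p" arbitrary: p)
  case 0
  from 0(1) obtain a where p: "p = [:a:]" by (metis degree_eq_zeroE)
  with 0 have "a \<noteq> 0" by simp
  then have "v = free_const (inverse a) * free_const a \<rhd> v"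
    using S(1) v(1) by (simp add: free_const_simps subsetD flip: free_const_simps(6))
  also have "\<dots> = \<zero>\<^bsub>V\<^esub>" using 0 p S(1) v(1) by (simp add: act_mult subsetD)
  finally show ?case .
next
  case (Suc n)
  have "\<not> constant (poly p)" using Suc(2) by (simp add: constant_degree)
  then obtain z where "poly p z = 0" using fundamental_theorem_of_algebra by blast
  then obtain r where r: "p = [:- z, 1:] * r" by (metis poly_eq_0_iff_dvd dvdE)
  with Suc have "r \<noteq> 0" by auto
  with Suc(2) have "degree r = n" unfolding r by (subst (asm) degree_mult_eq) auto
  have "t - free_const z \<rhd> free_eval t r \<rhd> v = \<zero>\<^bsub>V\<^esub>"
    using Suc(3) v(1) S(1) unfolding r free_eval_mult
    by (simp add: act_mult subsetD free_const_simps)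
  then have "free_eval t r \<rhd> v = \<zero>\<^bsub>V\<^esub>" using inj S(2) v(1) by blast
  with Suc(1) \<open>degree r = n\<close> \<open>r \<noteq> 0\<close> show ?case by blast
qed

text \<open>
  If \<open>t - c\<close> were injective for all \<open>c\<close>, the vectors \<open>inverse (t - c) v\<close>, which are of the form
  \<open>f c v\<close>, would be an uncountable linearly independent family.
\<close>

lemma central_acts_by_scalar:
  assumes S: "S \<subseteq> carrier V" "\<And>p w. p \<in> B \<Longrightarrow> w \<in> S \<Longrightarrow> p \<rhd> w \<in> S"
    and B: "\<And>c. free_const c \<in> B" "\<And>p r. p \<in> B \<Longrightarrow> r \<in> B \<Longrightarrow> p + r \<in> B"
      "\<And>p r. p \<in> B \<Longrightarrow> r \<in> B \<Longrightarrow> p * r \<in> B"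
    and cyclic: "\<And>w y. w \<in> S \<Longrightarrow> w \<noteq> \<zero>\<^bsub>V\<^esub> \<Longrightarrow> y \<in> S \<Longrightarrow> \<exists>p\<in>B. y = p \<rhd> w"
    and t: "t \<in> B" "\<And>p w. p \<in> B \<Longrightarrow> w \<in> S \<Longrightarrow> t * p \<rhd> w = p * t \<rhd> w"
  shows "\<exists>c. \<forall>w\<in>S. t \<rhd> w = free_const c \<rhd> w"
proof -
  have SV: "w \<in> carrier V" if "w \<in> S" for w using that S(1) by blast
  have tc: "(t - free_const c) * p \<rhd> w = p * (t - free_const c) \<rhd> w"
    if "p \<in> B" "w \<in> S" for p w c
    unfolding left_diff_distrib right_diff_distrib
    by (rule act_diff_cong) (simp_all add: SV that t(2) free_const_commute)
  have tB: "t - free_const c \<in> B" for c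
    using B(2)[OF t(1) B(1)[of "- c"]] by (simp add: free_const_simps)
  have eB: "free_eval t p \<in> B" for p
  proof (induction p)
    case 0
    show ?case using B(1)[of 0] by (simp add: free_const_simps)
  qed (simp add: B t(1))
  show ?thesis
  proof (cases "\<exists>c w. w \<in> S \<and> w \<noteq> \<zero>\<^bsub>V\<^esub> \<and> t - free_const c \<rhd> w = \<zero>\<^bsub>V\<^esub>")
    case True
    then obtain c w where w: "w \<in> S" "w \<noteq> \<zero>\<^bsub>V\<^esub>" "t - free_const c \<rhd> w = \<zero>\<^bsub>V\<^esub>" by blast
    \<comment> \<open>One eigenvector \<open>w\<close> suffices: it generates \<open>S\<close> under
      \<open>B\<close>, and \<open>t - c\<close> commutes with \<open>B\<close>.\<close>
    have "t \<rhd> y = free_const c \<rhd> y" if y: "y \<in> S" for y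
    proof -
      from cyclic[OF w(1,2) y] obtain p where p: "p \<in> B" "y = p \<rhd> w" by blast
      have "t - free_const c \<rhd> y = (t - free_const c) * p \<rhd> w"
        by (simp add: p(2) act_mult SV w(1))
      also have "\<dots> = \<zero>\<^bsub>V\<^esub>" unfolding tc[OF p(1) w(1)] by (simp add: act_mult SV w)
      finally show ?thesis by (simp add: act_eq_iff SV y)
    qed
    then show ?thesis by blast
  next
    case False
    then have inj: "w = \<zero>\<^bsub>V\<^esub>" if "w \<in> S" "t - free_const z \<rhd> w = \<zero>\<^bsub>V\<^esub>" for z w
      using that by blast
    have "v = \<zero>\<^bsub>V\<^esub>" if v: "v \<in> S" for v
    proof (rule ccontr)
      assume v0: "v \<noteq> \<zero>\<^bsub>V\<^esub>"
      \<comment> \<open>Since \<open>t - c\<close> does not kill \<open>v\<close>, the image of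
        \<open>v\<close> generates \<open>S\<close>; hence some element \<open>f c\<close> of
        \<open>B\<close> inverts \<open>t - c\<close> on \<open>v\<close>.\<close>
      have "\<exists>p\<in>B. v = p \<rhd> t - free_const c \<rhd> v" for c
        using cyclic[of "t - free_const c \<rhd> v" v] S(2)[OF tB v] inj[OF v] v v0 by blast
      then obtain f where f: "\<And>c. f c \<in> B" "\<And>c. v = f c \<rhd> t - free_const c \<rhd> v" by metis
      have fv: "(t - free_const c) * f c \<rhd> v = v" for c
        unfolding tc[OF f(1) v] using f(2)[of c] by (simp add: act_mult SV v)
      obtain F u where F: "finite F" "\<exists>d\<in>F. u d \<noteq> 0" "(\<Sum>c\<in>F. free_const (u c) * f c) = 0"
        using uncountable_family_dependent by blast
      \<comment> \<open>Multiplying the relation among the \<open>f c\<close> by the common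
        denominator \<open>N F\<close> turns it into \<open>P(t) v = 0\<close> for an ordinary
        polynomial \<open>P\<close>.\<close>
      define N where "N = (\<lambda>A::complex set. \<Prod>c\<in>A. [:- c, 1:])"
      define P where "P = (\<Sum>c\<in>F. smult (u c) (N (F - {c})))"
      have Nc: "free_eval t (N F) * f c \<rhd> v = free_eval t (N (F - {c})) \<rhd> v" if "c \<in> F" for c
      proof -
        have "N F = N (F - {c}) * [:- c, 1:]"
          unfolding N_def using F(1) that by (subst prod.remove[of F c]) (auto simp: mult.commute)
        then have "free_eval t (N F) * f c = free_eval t (N (F - {c})) * ((t - free_const c) * f c)"
          by (simp only: free_eval_mult) (simp add: free_const_simps mult.assoc)
        then show ?thesis by (metis act_mult fv SV v)
      qed
      have "free_eval t P \<rhd> v = (\<Sum>c\<in>F. free_const (u c) * free_eval t (N (F - {c}))) \<rhd> v"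
        by (simp add: P_def free_eval_sum free_eval_smult)
      also have "\<dots> = (\<Sum>c\<in>F. free_const (u c) * (free_eval t (N F) * f c)) \<rhd> v"
        by (rule act_sum_cong) (simp_all add: SV v act_mult[of v "free_const _"] Nc)
      also have "(\<Sum>c\<in>F. free_const (u c) * (free_eval t (N F) * f c))
          = free_eval t (N F) * (\<Sum>c\<in>F. free_const (u c) * f c)"
        by (simp add: sum_distrib_left mult.assoc[symmetric] free_const_commute)
      finally have "free_eval t P \<rhd> v = \<zero>\<^bsub>V\<^esub>" by (simp add: F(3) SV v)
      moreover have "P \<noteq> 0"
      proof
        assume "P = 0"
        obtain d where d: "d \<in> F" "u d \<noteq> 0" using F(2) by blast
        have N: "poly (N A) d = (\<Prod>c\<in>A. d - c)" for A by (simp add: N_def poly_prod)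
        \<comment> \<open>As in Lagrange interpolation, every summand with
          \<open>c \<noteq> d\<close> contains the linear factor vanishing at
          \<open>d\<close>.\<close>
        have "poly P d = (\<Sum>c\<in>F. if c = d then u d * poly (N (F - {d})) d else 0)"
          unfolding P_def poly_sum
          by (rule sum.cong) (use d F(1) in \<open>auto simp: N prod_zero_iff\<close>)
        also have "\<dots> = u d * (\<Prod>c\<in>F - {d}. d - c)" using d(1) F(1) by (simp add: N)
        finally have "poly P d \<noteq> 0" using d F(1) by (auto simp: prod_zero_iff)
        with \<open>P = 0\<close> show False by simp
      qed
      ultimately have "v = \<zero>\<^bsub>V\<^esub>"
        by (intro free_eval_eq_zeroD[of S t v P]) (use inj S eB v in auto)
      with v0 show False ..
    qed
    \<comment> \<open>Now \<open>S\<close> contains no nonzero vector, so any scalar serves.\<close>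
    then have "t \<rhd> w = free_const 0 \<rhd> w" if "w \<in> S" for w
      by (metis that act_zero_right)
    then show ?thesis by blast
  qed
qed

text \<open>Every monomial arises from a constant by multiplying one generator at a time from the
  left, and sums of monomials exhaust the free algebra.\<close>

lemma act_invariant:
  assumes "H \<subseteq> carrier V" "\<zero>\<^bsub>V\<^esub> \<in> H" "\<And>x y. x \<in> H \<Longrightarrow> y \<in> H \<Longrightarrow> x \<oplus>\<^bsub>V\<^esub> y \<in> H"
    and const: "\<And>a x. x \<in> H \<Longrightarrow> free_const a \<rhd> x \<in> H"
    and gen: "\<And>g x. x \<in> H \<Longrightarrow> free_gen g \<rhd> x \<in> H"
    and "w \<in> H"
  shows "p \<rhd> w \<in> H"
proof (induction p rule: free_induct)
  case zero
  show ?case using assms(1,2,6) by (simp add: subsetD)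
next
  case (add u a p)
  have "Poly_Mapping.single (Word l) a \<rhd> w \<in> H" for l
  proof (induction l)
    case Nil
    show ?case using const[OF \<open>w \<in> H\<close>, of a] by (simp add: free_const_def zero_word_def)
  next
    case (Cons g l)
    have "Poly_Mapping.single (Word (g # l)) a = free_gen g * Poly_Mapping.single (Word l) a"
      by (simp add: free_gen_def mult_single plus_word_def)
    with gen[OF Cons] show ?case using assms(1,6) by (simp add: act_mult subsetD)
  qed
  from this[of "letters u"] add assms(1,3,6) show ?case by (simp add: act_add subsetD)
qed

section \<open>Weight vectors of the commuting pair \<open>X12\<close>, \<open>X21\<close>\<close>

text \<open>The zero vector has every weight, so weights can be transported by \<open>X11\<close>
  and \<open>X22\<close> without knowing that the image is nonzero.\<close>

definition weight :: "complex \<Rightarrow> complex \<Rightarrow> 'v \<Rightarrow> bool" where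
  "weight \<eta> \<gamma> w \<longleftrightarrow> w \<in> carrier V \<and> free_gen X12 \<rhd> w = free_const \<eta> \<rhd> w \<and>
     free_gen X21 \<rhd> w = free_const \<gamma> \<rhd> w"

lemma weight_carrier: "weight \<eta> \<gamma> w \<Longrightarrow> w \<in> carrier V"
  by (simp add: weight_def)

lemma act_const_swap: "v \<in> carrier V \<Longrightarrow>
   free_gen g \<rhd> free_const a \<rhd> v = free_const a \<rhd> free_gen g \<rhd> v"
  by (metis act_mult free_const_commute)

lemma act_const_const: "v \<in> carrier V \<Longrightarrow> free_const a \<rhd> free_const b \<rhd> v = free_const (a * b) \<rhd> v"
  by (simp add: act_mult free_const_simps)

lemma act_const_one [simp]: "v \<in> carrier V \<Longrightarrow> free_const 1 \<rhd> v = v"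
  by (simp add: free_const_simps)

lemma act_const_eq_zero:
  assumes "v \<in> carrier V" "free_const a \<rhd> v = \<zero>\<^bsub>V\<^esub>" "a \<noteq> 0"
  shows "v = \<zero>\<^bsub>V\<^esub>"
  using act_const_const[OF assms(1), of "inverse a" a] assms by simp

lemma weight_const:
  assumes "weight \<eta> \<gamma> w"
  shows "weight \<eta> \<gamma> (free_const a \<rhd> w)"
  using assms by (simp add: weight_def act_const_swap act_const_const mult.commute)

lemma weight_X22:
  assumes "weight \<eta> \<gamma> w"
  shows "weight (q * \<eta>) (q * \<gamma>) (free_gen X22 \<rhd> w)"
  using assms act_relations(3,4)[of w]
  by (simp add: weight_def act_mult act_const_swap act_const_const)

text \<open>The relations put the factor \<open>q\<close> on the side of the unknown eigenvalue, so
  it has to be cancelled; the local statement treats \<open>X12\<close> and \<open>X21\<close> at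
  once.\<close>

lemma weight_X11:
  assumes "weight \<eta> \<gamma> w" and q: "q \<noteq> 0"
  shows "weight (\<eta> / q) (\<gamma> / q) (free_gen X11 \<rhd> w)"
proof -
  note w = assms(1)[unfolded weight_def]
  have "free_gen g \<rhd> free_gen X11 \<rhd> w = free_const (a / q) \<rhd> free_gen X11 \<rhd> w"
    if rel: "free_gen X11 * free_gen g \<rhd> w = free_const q * free_gen g * free_gen X11 \<rhd> w"
      and g: "free_gen g \<rhd> w = free_const a \<rhd> w" for g a
  proof -
    have "free_const q \<rhd> free_gen g \<rhd> free_gen X11 \<rhd> w = free_const a \<rhd> free_gen X11 \<rhd> w"
      using rel w g by (simp add: act_mult act_const_swap)
    then have "free_const (inverse q) \<rhd> free_const q \<rhd> free_gen g \<rhd> free_gen X11 \<rhd> w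
        = free_const (inverse q) \<rhd> free_const a \<rhd> free_gen X11 \<rhd> w" by simp
    then show ?thesis using w q by (simp add: act_const_const field_simps)
  qed
  with w act_relations(1,2)[of w] show ?thesis by (simp add: weight_def)
qed

text \<open>This is the quantum determinant relation evaluated on a weight vector.\<close>

lemma weight_X11_X22:
  assumes "weight \<eta> \<gamma> w"
  shows "free_gen X11 \<rhd> free_gen X22 \<rhd> w = free_const (1 + q * \<eta> * \<gamma>) \<rhd> w"
proof -
  have w: "w \<in> carrier V" "free_gen X12 \<rhd> w = free_const \<eta> \<rhd> w"
    "free_gen X21 \<rhd> w = free_const \<gamma> \<rhd> w" using assms by (simp_all add: weight_def)
  have *: "free_const q * free_gen X12 * free_gen X21 \<rhd> w = free_const (q * \<eta> * \<gamma>) \<rhd> w"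
    using w by (simp add: act_mult act_const_swap act_const_const mult_ac)
  have "free_gen X11 * free_gen X22 \<rhd> w
      = (free_gen X11 * free_gen X22 - free_const q * free_gen X12 * free_gen X21)
        + free_const q * free_gen X12 * free_gen X21 \<rhd> w" by simp
  also have "\<dots> = 1 + free_const (q * \<eta> * \<gamma>) \<rhd> w"
    by (simp only: act_add w(1) act_relations(7) *)
  finally show ?thesis using w(1) by (simp add: act_mult free_const_simps)
qed

text \<open>Subtracting the commutator relation from the determinant relation replaces the factor
  \<open>q\<close> of \<open>\<eta> * \<gamma>\<close> by
  \<open>q - (q - inverse q)\<close>.\<close>

lemma weight_X22_X11:
  assumes "weight \<eta> \<gamma> w"
  shows "free_gen X22 \<rhd> free_gen X11 \<rhd> w = free_const (1 + \<eta> * \<gamma> / q) \<rhd> w"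
proof -
  have w: "w \<in> carrier V" "free_gen X12 \<rhd> w = free_const \<eta> \<rhd> w"
    "free_gen X21 \<rhd> w = free_const \<gamma> \<rhd> w" using assms by (simp_all add: weight_def)
  have *: "free_const (q - inverse q) * free_gen X12 * free_gen X21 \<rhd> w
      = free_const ((q - inverse q) * \<eta> * \<gamma>) \<rhd> w"
    using w by (simp add: act_mult act_const_swap act_const_const mult_ac)
  have "free_gen X22 * free_gen X11 \<rhd> w
      = free_gen X11 * free_gen X22 - (free_gen X11 * free_gen X22 - free_gen X22 * free_gen X11) \<rhd> w"
    by simp
  also have "\<dots> = free_const (1 + q * \<eta> * \<gamma>) - free_const ((q - inverse q) * \<eta> * \<gamma>) \<rhd> w"
    using weight_X11_X22[OF assms] by (intro act_diff_cong) (simp_all add: w(1) act_relations(6) * act_mult)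
  also have "\<dots> = free_const (1 + \<eta> * \<gamma> / q) \<rhd> w"
    by (simp add: algebra_simps divide_inverse flip: free_const_simps)
  finally show ?thesis using w(1) by (simp add: act_mult)
qed

end

section \<open>A weight vector from a simple summand\<close>

text \<open>The multiples of \<open>w\<close> form a submodule containing \<open>w\<close>, which
  simplicity forces to be everything. The ring is arbitrary because this is applied both to
  \<open>Cq_SL2 q\<close> and to its commutative subalgebra.\<close>

lemma simple_module_cyclic:
  assumes simple: "simple_module R M" and w: "w \<in> carrier M" "w \<noteq> \<zero>\<^bsub>M\<^esub>" and y: "y \<in> carrier M"
  shows "\<exists>a\<in>carrier R. y = a \<odot>\<^bsub>M\<^esub> w"
proof -
  interpret left_module R M using simple by (simp add: simple_module_def)
  let ?N = "(\<lambda>a. a \<odot>\<^bsub>M\<^esub> w) ` carrier R"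
  have zero: "\<zero>\<^bsub>R\<^esub> \<odot>\<^bsub>M\<^esub> w = \<zero>\<^bsub>M\<^esub>"
    using smult_l_distr[of "\<zero>\<^bsub>R\<^esub>" "\<zero>\<^bsub>R\<^esub>" w] w(1) smult_closed[of "\<zero>\<^bsub>R\<^esub>" w]
    by (metis M.add.l_cancel_one R.l_zero R.zero_closed)
  have minus: "(\<ominus>\<^bsub>R\<^esub> a) \<odot>\<^bsub>M\<^esub> w = \<ominus>\<^bsub>M\<^esub> (a \<odot>\<^bsub>M\<^esub> w)" if "a \<in> carrier R" for a
    using smult_l_distr[of "\<ominus>\<^bsub>R\<^esub> a" a w] that w(1) zero smult_closed
    by (simp add: R.l_neg M.minus_equality)
  have "submodule ?N R M"
  proof (intro submodule.intro submodule_axioms.intro)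
    show "subgroup ?N (add_monoid M)"
    proof (rule group.subgroupI[OF M.a_group])
      show "inv\<^bsub>add_monoid M\<^esub> x \<in> ?N" if x: "x \<in> ?N" for x
      proof -
        from x obtain a where a: "a \<in> carrier R" "x = a \<odot>\<^bsub>M\<^esub> w" by blast
        have "inv\<^bsub>add_monoid M\<^esub> x = (\<ominus>\<^bsub>R\<^esub> a) \<odot>\<^bsub>M\<^esub> w"
          using minus[OF a(1)] a(2) by (simp add: a_inv_def)
        with a(1) show ?thesis by blast
      qed
      show "x \<otimes>\<^bsub>add_monoid M\<^esub> z \<in> ?N" if "x \<in> ?N" "z \<in> ?N" for x z
        using that smult_l_distr w(1) by (force simp flip: smult_l_distr)
    qed (use w smult_closed in auto)
    show "a \<odot>\<^bsub>M\<^esub> x \<in> ?N" if "a \<in> carrier R" "x \<in> ?N" for a x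
      using that w(1) by (force simp flip: smult_assoc)
  qed
  moreover have "w \<in> ?N" using smult_one[OF w(1)] by (metis R.one_closed imageI)
  ultimately have "?N = carrier M" using simple w(2) by (auto simp: simple_module_def)
  with y show ?thesis by blast
qed

text \<open>An empty family of summands would generate only zero.\<close>

lemma semisimple_module_obtains_simple:
  assumes "semisimple_module R M" "carrier M \<noteq> {\<zero>\<^bsub>M\<^esub>}"
  obtains S where "simple_submodule S R M"
proof -
  obtain F where F: "\<And>S. S \<in> F \<Longrightarrow> simple_submodule S R M"
    "generate (add_monoid M) (\<Union>F) = carrier M"
    using assms(1) by (auto simp: semisimple_module_def)
  have "group (add_monoid M)"
    using assms(1) abelian_group.a_group by (auto simp: semisimple_module_def left_module_def)
  then have "F \<noteq> {}" using F(2) assms(2) group.generate_empty by fastforce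
  with F(1) that show ?thesis by blast
qed

text \<open>The centraliser of \<open>t\<close> is closed under the ring operations.\<close>

lemma (in ring) generate_ring_commute:
  assumes "H \<subseteq> carrier R" "t \<in> carrier R" "\<And>h. h \<in> H \<Longrightarrow> t \<otimes> h = h \<otimes> t"
    and "a \<in> generate_ring R H"
  shows "t \<otimes> a = a \<otimes> t"
proof -
  note cl = generate_ring_in_carrier[OF assms(1)]
  from assms(4) show ?thesis
  proof induction
    case (eng_mult a b)
    then show ?case using assms(2) cl by (metis m_assoc)
  qed (use assms cl in \<open>simp_all add: l_minus r_minus l_distr r_distr\<close>)
qed

context Cq_module
begin

text \<open>Both generators are central in the subalgebra, so \<open>central_acts_by_scalar\<close>
  makes each of them a scalar on all of \<open>S\<close>, and every nonzero vector of
  \<open>S\<close> is a weight vector.\<close>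

lemma simple_submodule_weight:
  assumes S: "simple_submodule S ((Cq_SL2 q)\<lparr>carrier := Cq_subalgebra q {X12, X21}\<rparr>) V"
  obtains v \<eta> \<gamma> where "weight \<eta> \<gamma> v" "v \<noteq> \<zero>\<^bsub>V\<^esub>"
proof -
  interpret R: ring "Cq_SL2 q" by (rule ring_Cq_SL2)
  let ?H = "range (\<lambda>c. Cq_class q (free_const c)) \<union> Cq_gen q ` {X12, X21}"
  let ?A = "Cq_subalgebra q {X12, X21}"
  have H: "?H \<subseteq> carrier (Cq_SL2 q)" by (auto simp: carrier_Cq_SL2 Cq_gen_def)
  have A: "?A \<subseteq> carrier (Cq_SL2 q)"
    unfolding Cq_subalgebra_def by (rule R.generate_ring_incl[OF H])
  \<comment> \<open>The preimage of the subalgebra in the free algebra, since Dixmier's argument is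
    phrased for representatives.\<close>
  define B where "B = {p. Cq_class q p \<in> ?A}"
  have B: "free_const c \<in> B" "p \<in> B \<Longrightarrow> r \<in> B \<Longrightarrow> p + r \<in> B" "p \<in> B \<Longrightarrow> r \<in> B \<Longrightarrow> p * r \<in> B"
    "free_gen X12 \<in> B" "free_gen X21 \<in> B" for c p r
    unfolding B_def Cq_subalgebra_def mem_Collect_eq Cq_class_simps[symmetric]
    by (auto intro: generate_ring.intros simp: Cq_gen_def)
  have gens: "Cq_gen q X12 \<otimes>\<^bsub>Cq_SL2 q\<^esub> Cq_gen q X21 = Cq_gen q X21 \<otimes>\<^bsub>Cq_SL2 q\<^esub> Cq_gen q X12"
    unfolding Cq_gen_def Cq_class_simps
    by (rule Cq_class_eqI, rule subsetD[OF sl2_relations_subset]) (simp add: sl2_relations_def Let_def)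
  have comm: "free_gen g * p \<rhd> w = p * free_gen g \<rhd> w" if "g \<in> {X12, X21}" "p \<in> B" for g p w
  proof -
    have "Cq_gen q g \<otimes>\<^bsub>Cq_SL2 q\<^esub> Cq_class q p = Cq_class q p \<otimes>\<^bsub>Cq_SL2 q\<^esub> Cq_gen q g"
    proof (rule R.generate_ring_commute[OF H])
      show "Cq_class q p \<in> generate_ring (Cq_SL2 q) ?H"
        using that(2) by (simp add: B_def Cq_subalgebra_def)
      show "Cq_gen q g \<in> carrier (Cq_SL2 q)" by (simp add: carrier_Cq_SL2 Cq_gen_def)
      show "Cq_gen q g \<otimes>\<^bsub>Cq_SL2 q\<^esub> h = h \<otimes>\<^bsub>Cq_SL2 q\<^esub> Cq_gen q g" if "h \<in> ?H" for h
        using that \<open>g \<in> _\<close> gens by (auto simp: Cq_gen_def Cq_class_simps free_const_commute)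
    qed
    then show ?thesis by (simp add: act_def Cq_gen_def Cq_class_simps)
  qed
  have sub: "submodule S ((Cq_SL2 q)\<lparr>carrier := ?A\<rparr>) V"
    and simp: "simple_module ((Cq_SL2 q)\<lparr>carrier := ?A\<rparr>) (V\<lparr>carrier := S\<rparr>)"
    using S by (auto simp: simple_submodule_def)
  have SV: "S \<subseteq> carrier V" using submodule.axioms(1)[OF sub] subgroup.subset by fastforce
  have closed: "p \<rhd> w \<in> S" if "p \<in> B" "w \<in> S" for p w
    using submodule.smult_closed[OF sub] that by (simp add: B_def act_def)
  have cyclic: "\<exists>p\<in>B. y = p \<rhd> w" if "w \<in> S" "w \<noteq> \<zero>\<^bsub>V\<^esub>" "y \<in> S" for w y
    using simple_module_cyclic[OF simp, of w y] that A
    by (fastforce simp: carrier_Cq_SL2 B_def act_def)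
  have scalar: "\<exists>c. \<forall>w\<in>S. free_gen g \<rhd> w = free_const c \<rhd> w" if "g \<in> {X12, X21}" for g
    by (rule central_acts_by_scalar[of S B]) (use SV closed B cyclic comm that in auto)
  obtain \<eta> where \<eta>: "\<forall>w\<in>S. free_gen X12 \<rhd> w = free_const \<eta> \<rhd> w" using scalar by blast
  obtain \<gamma> where \<gamma>: "\<forall>w\<in>S. free_gen X21 \<rhd> w = free_const \<gamma> \<rhd> w" using scalar by blast
  have "S \<noteq> {\<zero>\<^bsub>V\<^esub>}" "\<zero>\<^bsub>V\<^esub> \<in> S"
    using simp subgroup.one_closed[OF submodule.axioms(1)[OF sub]] by (auto simp: simple_module_def)
  then obtain v where "v \<in> S" "v \<noteq> \<zero>\<^bsub>V\<^esub>" by blast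
  with \<eta> \<gamma> SV that[of \<eta> \<gamma> v] show ?thesis by (auto simp: weight_def)
qed

end

section \<open>Powers of \<open>q\<close> and the normalised orbit of a weight vector\<close>

lemma power_int_eq_iff_of_not_root_of_unity:
  fixes q :: "'a::field"
  assumes "q \<noteq> 0" "\<forall>n::nat. n > 0 \<longrightarrow> q ^ n \<noteq> 1"
  shows "q powi i = q powi j \<longleftrightarrow> i = j"
proof -
  have "i = j" if "q powi i = q powi j" "i \<le> j" for i j
  proof -
    have "q powi (j - i) = 1" using that(1) assms(1) by (simp add: power_int_diff)
    then have "q ^ nat (j - i) = 1" using that(2) by (simp add: power_int_def)
    then have "\<not> 0 < nat (j - i)" using assms(2) by blast
    then show ?thesis using that(2) by simp
  qed
  from this[of i j] this[of j i] show ?thesis by (metis linear)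
qed

text \<open>
  \<open>orbit c i\<close> sends a weight vector to its multiple that corresponds to \<open>e i\<close>. Past the boundary of
  the index set the normalising factor is the junk value \<open>inverse 0 = 0\<close>, which is harmless.
\<close>

primrec orbit_up :: "(gen \<Rightarrow> int \<Rightarrow> complex) \<Rightarrow> nat \<Rightarrow> free" where
  "orbit_up c 0 = 1"
| "orbit_up c (Suc n) = free_const (inverse (c X22 (int n))) * free_gen X22 * orbit_up c n"

primrec orbit_down :: "(gen \<Rightarrow> int \<Rightarrow> complex) \<Rightarrow> nat \<Rightarrow> free" where
  "orbit_down c 0 = 1"
| "orbit_down c (Suc n) = free_const (inverse (c X11 (- int n))) * free_gen X11 * orbit_down c n"

definition orbit :: "(gen \<Rightarrow> int \<Rightarrow> complex) \<Rightarrow> int \<Rightarrow> free" where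
  "orbit c i = (if 0 \<le> i then orbit_up c (nat i) else orbit_down c (nat (- i)))"

lemma orbit_0 [simp]: "orbit c 0 = 1"
  by (simp add: orbit_def)

lemma orbit_Suc: "0 \<le> i \<Longrightarrow> orbit c (i + 1) = free_const (inverse (c X22 i)) * free_gen X22 * orbit c i"
  by (simp add: orbit_def nat_add_distrib)

lemma orbit_pred:
  assumes "i \<le> 0"
  shows "orbit c (i - 1) = free_const (inverse (c X11 i)) * free_gen X11 * orbit c i"
proof -
  obtain n where n: "i = - int n" using assms by (metis minus_minus nonneg_int_cases neg_0_le_iff_le)
  have "nat (1 + int n) = Suc n" by simp
  then show ?thesis by (cases n) (simp_all add: orbit_def n nat_add_distrib)
qed

text \<open>The linear extension of sending \<open>e i\<close> to \<open>orbit c i\<close>. Acting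
  with it on a weight vector gives the candidate isomorphism from the typical module to
  \<open>V\<close>.\<close>

definition orbit_comb :: "(gen \<Rightarrow> int \<Rightarrow> complex) \<Rightarrow> (int \<Rightarrow>\<^sub>0 complex) \<Rightarrow> free" where
  "orbit_comb c f = (\<Sum>i\<in>Poly_Mapping.keys f. free_const (Poly_Mapping.lookup f i) * orbit c i)"

lemma orbit_comb_superset:
  assumes "finite A" "Poly_Mapping.keys f \<subseteq> A"
  shows "orbit_comb c f = (\<Sum>i\<in>A. free_const (Poly_Mapping.lookup f i) * orbit c i)"
  unfolding orbit_comb_def
  by (rule sum.mono_neutral_left) (use assms in \<open>auto simp: in_keys_iff free_const_simps\<close>)

lemma orbit_comb_zero [simp]: "orbit_comb c 0 = 0"
  by (simp add: orbit_comb_def)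

lemma orbit_comb_single: "orbit_comb c (Poly_Mapping.single i a) = free_const a * orbit c i"
  by (subst orbit_comb_superset[of "{i}"]) auto

lemma orbit_comb_add: "orbit_comb c (f + h) = orbit_comb c f + orbit_comb c h"
proof -
  let ?A = "Poly_Mapping.keys f \<union> Poly_Mapping.keys h"
  have "Poly_Mapping.keys (f + h) \<subseteq> ?A" by (rule Poly_Mapping.keys_add)
  then show ?thesis
    by (simp add: orbit_comb_superset[of ?A] lookup_add free_const_simps distrib_right sum.distrib)
qed

lemma orbit_comb_scale: "orbit_comb c (Poly_Mapping.map ((*) a) f) = free_const a * orbit_comb c f"
proof -
  have "Poly_Mapping.keys (Poly_Mapping.map ((*) a) f) \<subseteq> Poly_Mapping.keys f"
    by (auto simp: in_keys_iff lookup_scale)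
  then show ?thesis
    by (simp add: orbit_comb_superset[of "Poly_Mapping.keys f"] lookup_scale free_const_simps
        sum_distrib_left mult.assoc)
qed

lemma orbit_comb_gen_action:
  "orbit_comb c (gen_action c g f)
     = (\<Sum>i\<in>Poly_Mapping.keys f.
          free_const (c g i * Poly_Mapping.lookup f i) * orbit c (i + gen_shift g))"
proof -
  have "orbit_comb c (\<Sum>i\<in>A. F i) = (\<Sum>i\<in>A. orbit_comb c (F i))" for A :: "int set" and F
    by (induction A rule: infinite_finite_induct) (simp_all add: orbit_comb_add)
  then show ?thesis by (simp add: gen_action_def orbit_comb_single)
qed

section \<open>A common criterion for being isomorphic to a typical module\<close>

text \<open>The natural map starts at the typical module, whereas \<open>module_iso\<close> asks for
  one starting at \<open>V\<close>; the inverse of \<open>\<phi>\<close> is additive and equivariant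
  as well.\<close>

lemma module_iso_typicalI:
  assumes "compatible q I c"
    and bij: "bij_betw \<phi> {v. Poly_Mapping.keys v \<subseteq> I} (carrier V)"
    and add: "\<And>x y. Poly_Mapping.keys x \<subseteq> I \<Longrightarrow> Poly_Mapping.keys y \<subseteq> I \<Longrightarrow>
      \<phi> (x + y) = \<phi> x \<oplus>\<^bsub>V\<^esub> \<phi> y"
    and smult: "\<And>p x. Poly_Mapping.keys x \<subseteq> I \<Longrightarrow>
      \<phi> (free_action c p x) = Cq_class q p \<odot>\<^bsub>V\<^esub> \<phi> x"
  shows "module_iso (Cq_SL2 q) V (typical_module I c)"
proof -
  let ?C = "{v. Poly_Mapping.keys v \<subseteq> I}"
  let ?\<psi> = "inv_into ?C \<phi>"
  have inv: "?\<psi> (\<phi> x) = x" if "Poly_Mapping.keys x \<subseteq> I" for x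
    using bij that by (auto simp: bij_betw_def inv_into_f_f)
  have surj: "\<exists>x. Poly_Mapping.keys x \<subseteq> I \<and> y = \<phi> x" if "y \<in> carrier V" for y
    using bij that by (auto simp: bij_betw_def)
  have "bij_betw ?\<psi> (carrier V) (carrier (typical_module I c))"
    using bij_betw_inv_into[OF bij] by (simp add: typical_module_def)
  moreover have "?\<psi> (x \<oplus>\<^bsub>V\<^esub> y) = ?\<psi> x \<oplus>\<^bsub>typical_module I c\<^esub> ?\<psi> y"
    if xy: "x \<in> carrier V" "y \<in> carrier V" for x y
  proof -
    obtain u v where uv: "Poly_Mapping.keys u \<subseteq> I" "x = \<phi> u" "Poly_Mapping.keys v \<subseteq> I" "y = \<phi> v"
      using surj xy by metis
    then have "Poly_Mapping.keys (u + v) \<subseteq> I" using Poly_Mapping.keys_add[of u v] by blast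
    then have "?\<psi> (\<phi> (u + v)) = u + v" by (rule inv)
    with uv show ?thesis by (simp add: add inv) (simp add: typical_module_def)
  qed
  moreover have "?\<psi> (a \<odot>\<^bsub>V\<^esub> x) = a \<odot>\<^bsub>typical_module I c\<^esub> ?\<psi> x"
    if a: "a \<in> carrier (Cq_SL2 q)" and x: "x \<in> carrier V" for a x
  proof -
    obtain u where u: "Poly_Mapping.keys u \<subseteq> I" "x = \<phi> u" using surj x by metis
    obtain p where p: "a = Cq_class q p" using a by (auto simp: carrier_Cq_SL2)
    have "?\<psi> (\<phi> (free_action c p u)) = free_action c p u"
      by (rule inv) (rule free_action_closed[OF assms(1) u(1)])
    with u p show ?thesis by (simp add: smult inv typical_module_smult[OF assms(1)])
  qed
  ultimately show ?thesis unfolding module_iso_def by blast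
qed

text \<open>One setting for the full line and both half lines, with \<open>v\<close> in the role of
  \<open>e 0\<close>. The assumption \<open>det\<close> is the value of \<open>X11 * X22\<close> on
  \<open>e i\<close>. Only one of the two eigenvalues has to be nonzero, so that the full line also
  covers the modules on which \<open>X12\<close> or \<open>X21\<close> acts as zero.\<close>

locale weight_orbit = Cq_module q V for q and V :: "(free set, 'v) module" +
  fixes I :: "int set" and c :: "gen \<Rightarrow> int \<Rightarrow> complex" and v :: 'v
  assumes simple: "simple_module (Cq_SL2 q) V"
    and q_nonzero: "q \<noteq> 0"
    and q_not_root_of_unity: "\<forall>n::nat. n > 0 \<longrightarrow> q ^ n \<noteq> 1"
    and compatible: "compatible q I c"
    and I: "I = UNIV \<or> I = {0..} \<or> I = {..0}"
    and eigenvalues: "\<And>i. c X12 i = q powi i * c X12 0" "\<And>i. c X21 i = q powi i * c X21 0"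
    and eigenvalue_nonzero: "c X12 0 \<noteq> 0 \<or> c X21 0 \<noteq> 0"
    and det: "\<And>i. c X22 i * c X11 (i + 1) = 1 + q * c X12 i * c X21 i"
    and weight_v: "weight (c X12 0) (c X21 0) v" and v_nonzero: "v \<noteq> \<zero>\<^bsub>V\<^esub>"
    and coeffs_nonzero: "\<And>i. i \<in> I \<Longrightarrow> i + 1 \<in> I \<Longrightarrow> c X22 i \<noteq> 0 \<and> c X11 (i + 1) \<noteq> 0"
    and boundary: "1 \<notin> I \<Longrightarrow> free_gen X22 \<rhd> v = \<zero>\<^bsub>V\<^esub>" "- 1 \<notin> I \<Longrightarrow> free_gen X11 \<rhd> v = \<zero>\<^bsub>V\<^esub>"
begin

lemma v_carrier: "v \<in> carrier V"
  using weight_v by (rule weight_carrier)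

lemma eigenvalues_Suc: "c X12 (i + 1) = q * c X12 i" "c X21 (i + 1) = q * c X21 i"
  using eigenvalues[of i] eigenvalues[of "i + 1"] q_nonzero
  by (simp_all add: power_int_add mult_ac)

text \<open>Above 0 the orbit is built with \<open>X22\<close>, whose action is therefore immediate;
  the action of \<open>X11\<close> back down follows from the scalar \<open>X11 * X22\<close> and
  \<open>det\<close>.\<close>

lemma step_up:
  assumes i: "i \<in> I" "i + 1 \<in> I" "0 \<le> i" and w: "weight (c X12 i) (c X21 i) (orbit c i \<rhd> v)"
  shows "free_gen X22 \<rhd> orbit c i \<rhd> v = free_const (c X22 i) \<rhd> orbit c (i + 1) \<rhd> v"
    and "free_gen X11 \<rhd> orbit c (i + 1) \<rhd> v = free_const (c X11 (i + 1)) \<rhd> orbit c i \<rhd> v"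
    and "weight (c X12 (i + 1)) (c X21 (i + 1)) (orbit c (i + 1) \<rhd> v)"
proof -
  note nz = coeffs_nonzero[OF i(1,2)]
  have e: "orbit c (i + 1) \<rhd> v = free_const (inverse (c X22 i)) \<rhd> free_gen X22 \<rhd> orbit c i \<rhd> v"
    by (simp add: orbit_Suc i(3) act_mult v_carrier)
  show "free_gen X22 \<rhd> orbit c i \<rhd> v = free_const (c X22 i) \<rhd> orbit c (i + 1) \<rhd> v"
    using nz by (simp add: e act_const_const v_carrier)
  have "inverse (c X22 i) * (1 + q * c X12 i * c X21 i) = c X11 (i + 1)"
    using nz by (simp flip: det)
  then show "free_gen X11 \<rhd> orbit c (i + 1) \<rhd> v = free_const (c X11 (i + 1)) \<rhd> orbit c i \<rhd> v"
    by (simp add: e act_const_swap weight_X11_X22[OF w] act_const_const v_carrier)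
  show "weight (c X12 (i + 1)) (c X21 (i + 1)) (orbit c (i + 1) \<rhd> v)"
    unfolding e eigenvalues_Suc by (intro weight_const weight_X22 w)
qed

text \<open>Below 0 the roles are exchanged: \<open>X11\<close> acts by construction, and the action
  of \<open>X22\<close> comes from the scalar \<open>X22 * X11\<close> at the upper index
  \<open>i + 1\<close>.\<close>

lemma step_down:
  assumes i: "i \<in> I" "i + 1 \<in> I" "i < 0"
    and w: "weight (c X12 (i + 1)) (c X21 (i + 1)) (orbit c (i + 1) \<rhd> v)"
  shows "free_gen X22 \<rhd> orbit c i \<rhd> v = free_const (c X22 i) \<rhd> orbit c (i + 1) \<rhd> v"
    and "free_gen X11 \<rhd> orbit c (i + 1) \<rhd> v = free_const (c X11 (i + 1)) \<rhd> orbit c i \<rhd> v"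
    and "weight (c X12 i) (c X21 i) (orbit c i \<rhd> v)"
proof -
  note nz = coeffs_nonzero[OF i(1,2)]
  have "orbit c i = free_const (inverse (c X11 (i + 1))) * free_gen X11 * orbit c (i + 1)"
    using orbit_pred[of "i + 1" c] i(3) by simp
  then have e: "orbit c i \<rhd> v
      = free_const (inverse (c X11 (i + 1))) \<rhd> free_gen X11 \<rhd> orbit c (i + 1) \<rhd> v"
    by (simp add: act_mult v_carrier)
  show "free_gen X11 \<rhd> orbit c (i + 1) \<rhd> v = free_const (c X11 (i + 1)) \<rhd> orbit c i \<rhd> v"
    using nz by (simp add: e act_const_const v_carrier)
  have "1 + c X12 (i + 1) * c X21 (i + 1) / q = c X22 i * c X11 (i + 1)"
    using q_nonzero by (simp add: det eigenvalues_Suc mult_ac)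
  then have "inverse (c X11 (i + 1)) * (1 + c X12 (i + 1) * c X21 (i + 1) / q) = c X22 i"
    using nz by simp
  then show "free_gen X22 \<rhd> orbit c i \<rhd> v = free_const (c X22 i) \<rhd> orbit c (i + 1) \<rhd> v"
    by (simp add: e act_const_swap weight_X22_X11[OF w] act_const_const v_carrier)
  have "weight (c X12 (i + 1) / q) (c X21 (i + 1) / q) (orbit c i \<rhd> v)"
    unfolding e by (intro weight_const weight_X11 w q_nonzero)
  then show "weight (c X12 i) (c X21 i) (orbit c i \<rhd> v)"
    using q_nonzero by (simp add: eigenvalues_Suc)
qed

text \<open>Induction outwards from 0. All three shapes of \<open>I\<close> are intervals containing
  0, so the index before one in \<open>I\<close> is again in \<open>I\<close>.\<close>

lemma orbit_weight: "i \<in> I \<Longrightarrow> weight (c X12 i) (c X21 i) (orbit c i \<rhd> v)"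
proof (induction i rule: int_induct[of _ 0])
  case base
  show ?case using weight_v by (simp add: v_carrier)
next
  case (step1 i)
  then have "i \<in> I" using I by auto
  with step1 step_up(3) show ?case by blast
next
  case (step2 i)
  then have "i \<in> I" using I by auto
  with step2 step_down(3)[of "i - 1"] show ?case by simp
qed

lemma orbit_steps:
  assumes "i \<in> I" "i + 1 \<in> I"
  shows "free_gen X22 \<rhd> orbit c i \<rhd> v = free_const (c X22 i) \<rhd> orbit c (i + 1) \<rhd> v"
    and "free_gen X11 \<rhd> orbit c (i + 1) \<rhd> v = free_const (c X11 (i + 1)) \<rhd> orbit c i \<rhd> v"
  using step_up[OF assms] step_down[OF assms] orbit_weight assms by (meson not_le)+

text \<open>The opposite generator leads back to a nonzero multiple of the preceding orbit vector,
  so no step away from 0 can vanish.\<close>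

lemma orbit_nonzero: "i \<in> I \<Longrightarrow> orbit c i \<rhd> v \<noteq> \<zero>\<^bsub>V\<^esub>"
proof (induction i rule: int_induct[of _ 0])
  case base
  show ?case using v_nonzero by (simp add: v_carrier)
next
  case (step1 i)
  then have i: "i \<in> I" using I by auto
  with step1 orbit_steps(2)[OF i] coeffs_nonzero[OF i] show ?case
    using act_const_eq_zero[of "orbit c i \<rhd> v"] v_carrier by force
next
  case (step2 i)
  then have i: "i \<in> I" using I by auto
  with step2 orbit_steps(1)[of "i - 1"] coeffs_nonzero[of "i - 1"] show ?case
    using act_const_eq_zero[of "orbit c i \<rhd> v"] v_carrier by force
qed

lemma gen_act_orbit:
  assumes i: "i \<in> I"
  shows "free_gen g \<rhd> orbit c i \<rhd> v = free_const (c g i) \<rhd> orbit c (i + gen_shift g) \<rhd> v"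
proof (cases "i + gen_shift g \<in> I")
  case True
  then show ?thesis
    using orbit_weight[OF i] orbit_steps(1)[OF i] orbit_steps(2)[of "i - 1"] i
    by (cases g) (simp_all add: weight_def)
next
  case False
  then have c0: "c g i = 0" using compatible i by (auto simp: compatible_def)
  \<comment> \<open>A generator leaves \<open>I\<close> only at the end point 0 of a half line.
    There both sides vanish, so the junk orbit vector outside \<open>I\<close> does not
    matter.\<close>
  have "i = 0" "free_gen g \<rhd> v = \<zero>\<^bsub>V\<^esub>"
    using False i I boundary by (cases g; auto)+
  with c0 show ?thesis by (simp add: free_const_simps v_carrier)
qed

lemma gen_act_comb:
  assumes "Poly_Mapping.keys f \<subseteq> I"
  shows "orbit_comb c (gen_action c g f) \<rhd> v = free_gen g \<rhd> orbit_comb c f \<rhd> v"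
proof -
  have "free_gen g \<rhd> orbit_comb c f \<rhd> v
      = (\<Sum>i\<in>Poly_Mapping.keys f. free_gen g * (free_const (Poly_Mapping.lookup f i) * orbit c i)) \<rhd> v"
    by (simp add: orbit_comb_def sum_distrib_left v_carrier flip: act_mult)
  also have "\<dots> = orbit_comb c (gen_action c g f) \<rhd> v"
    unfolding orbit_comb_gen_action
    by (rule act_sum_cong)
      (use assms in \<open>auto simp: v_carrier act_mult act_const_swap gen_act_orbit act_const_const mult.commute\<close>)
  finally show ?thesis by simp
qed

text \<open>Equivariance under the generators extends to words letter by letter, since the
  coefficient vectors stay supported in \<open>I\<close>.\<close>

lemma free_act_comb:
  assumes f: "Poly_Mapping.keys f \<subseteq> I"
  shows "orbit_comb c (free_action c p f) \<rhd> v = p \<rhd> orbit_comb c f \<rhd> v"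
proof (induction p rule: free_induct)
  case zero
  show ?case by (simp add: free_action_zero v_carrier)
next
  case (add u a p)
  have one: "Poly_Mapping.map ((*) 1) h = h" for h :: "int \<Rightarrow>\<^sub>0 complex"
    by (rule poly_mapping_eqI) (simp add: lookup_scale)
  have keys: "Poly_Mapping.keys (foldr (gen_action c) l f) \<subseteq> I" for l
    using free_action_closed[OF compatible f, of "Poly_Mapping.single (Word l) 1"]
    by (simp add: free_action_single one)
  have "orbit_comb c (foldr (gen_action c) l f) \<rhd> v
      = Poly_Mapping.single (Word l) 1 \<rhd> orbit_comb c f \<rhd> v" for l
  proof (induction l)
    case Nil
    show ?case by (simp add: v_carrier flip: zero_word_def)
  next
    case (Cons g l)
    have "Poly_Mapping.single (Word (g # l)) 1 = free_gen g * Poly_Mapping.single (Word l) 1"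
      by (simp add: free_gen_def mult_single plus_word_def)
    with Cons show ?case by (simp add: gen_act_comb keys act_mult v_carrier)
  qed
  from this[of "letters u"] have "orbit_comb c (free_action c (Poly_Mapping.single u a) f) \<rhd> v
      = free_const a * Poly_Mapping.single u 1 \<rhd> orbit_comb c f \<rhd> v"
    by (simp add: free_action_single orbit_comb_scale act_mult v_carrier)
  then show ?case
    using add by (simp add: free_action_add orbit_comb_add act_add v_carrier free_const_def mult_single)
qed

text \<open>Eigenvectors with distinct eigenvalues are independent. The generator \<open>g\<close>
  with nonzero eigenvalue at 0 separates all indices because \<open>q\<close> is not a root of
  unity; the induction is on the size of the support.\<close>

lemma comb_eq_zeroD:
  assumes "Poly_Mapping.keys f \<subseteq> I" "orbit_comb c f \<rhd> v = \<zero>\<^bsub>V\<^esub>"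
  shows "f = 0"
  using assms
proof (induction "card (Poly_Mapping.keys f)" arbitrary: f rule: less_induct)
  case less
  show ?case
  proof (rule ccontr)
    assume "f \<noteq> 0"
    then obtain i where i: "i \<in> Poly_Mapping.keys f" by fastforce
    obtain g where g: "g \<in> {X12, X21}" "c g 0 \<noteq> 0" using eigenvalue_nonzero by blast
    then have "c g j = q powi j * c g 0" for j using eigenvalues by blast
    then have cg: "c g j = c g k \<longleftrightarrow> j = k" for j k
      using g(2) by (metis mult_cancel_right power_int_eq_iff_of_not_root_of_unity[OF q_nonzero q_not_root_of_unity])
    \<comment> \<open>applying \<open>x\<^sub>g - c g i\<close> kills exactly the coefficient at \<open>i\<close>\<close>
    define h where "h = gen_action c g f + Poly_Mapping.map ((*) (- c g i)) f"
    have "Poly_Mapping.lookup h j = (c g j - c g i) * Poly_Mapping.lookup f j" for j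
      using g(1) by (auto simp: h_def lookup_add lookup_gen_action lookup_scale algebra_simps)
    then have keys: "Poly_Mapping.keys h = Poly_Mapping.keys f - {i}"
      by (auto simp: in_keys_iff cg)
    have "orbit_comb c h \<rhd> v = \<zero>\<^bsub>V\<^esub>"
      using less.prems
      by (simp add: h_def orbit_comb_add orbit_comb_scale act_add v_carrier gen_act_comb act_mult)
    moreover have "card (Poly_Mapping.keys h) < card (Poly_Mapping.keys f)"
      unfolding keys by (rule card_Diff1_less) (simp_all add: i)
    ultimately have "h = 0" using less.hyps[of h] keys less.prems(1) by blast
    with keys i have "Poly_Mapping.keys f = {i}" by auto
    then have "free_const (Poly_Mapping.lookup f i) * orbit c i \<rhd> v = \<zero>\<^bsub>V\<^esub>"
      using less.prems(2) by (simp add: orbit_comb_def)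
    then have "orbit c i \<rhd> v = \<zero>\<^bsub>V\<^esub>"
      using act_const_eq_zero[of "orbit c i \<rhd> v"] i by (simp add: act_mult v_carrier in_keys_iff)
    with orbit_nonzero i less.prems(1) show False by blast
  qed
qed

lemma iso_typical: "module_iso (Cq_SL2 q) V (typical_module I c)"
proof (rule module_iso_typicalI[OF compatible, of "\<lambda>f. orbit_comb c f \<rhd> v"])
  let ?C = "{f. Poly_Mapping.keys f \<subseteq> I}"
  have "inj_on (\<lambda>f. orbit_comb c f \<rhd> v) ?C"
  proof (rule inj_onI)
    fix f h assume fh: "f \<in> ?C" "h \<in> ?C" "orbit_comb c f \<rhd> v = orbit_comb c h \<rhd> v"
    have eq: "orbit_comb c f = orbit_comb c (f - h) + orbit_comb c h"
      by (simp flip: orbit_comb_add)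
    have "orbit_comb c (f - h) \<rhd> v = \<zero>\<^bsub>V\<^esub>"
      using fh(3) unfolding eq by (simp add: act_add v_carrier)
    moreover have "Poly_Mapping.keys (f - h) \<subseteq> I"
      using fh(1,2) keys_diff[of f h] by blast
    ultimately show "f = h" using comb_eq_zeroD by fastforce
  qed
  moreover have "\<exists>f\<in>?C. y = orbit_comb c f \<rhd> v" if y: "y \<in> carrier V" for y
  proof -
    \<comment> \<open>The vector \<open>v\<close> is the image of \<open>e 0\<close>, so
      \<open>p\<close> acting on \<open>v\<close> is the image of \<open>p\<close> acting on
      \<open>e 0\<close>; surjectivity reduces to cyclicity.\<close>
    let ?e = "Poly_Mapping.single 0 (1::complex)"
    have e: "Poly_Mapping.keys ?e \<subseteq> I" using I by auto
    obtain p where "y = p \<rhd> v"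
      using simple_module_cyclic[OF simple v_carrier v_nonzero y]
      by (auto simp: carrier_Cq_SL2 act_def)
    then have "y = orbit_comb c (free_action c p ?e) \<rhd> v"
      by (simp add: free_act_comb[OF e] orbit_comb_single v_carrier free_const_simps del: single_one)
    with free_action_closed[OF compatible e] show ?thesis by blast
  qed
  ultimately show "bij_betw (\<lambda>f. orbit_comb c f \<rhd> v) ?C (carrier V)"
    by (auto simp: bij_betw_def v_carrier)
qed (simp_all add: orbit_comb_add act_add v_carrier free_act_comb flip: act_def)

end

section \<open>Generic and exceptional weights\<close>

context Cq_module
begin

context
  assumes simple: "simple_module (Cq_SL2 q) V"
    and q0: "q \<noteq> 0" and q1: "\<forall>n::nat. n > 0 \<longrightarrow> q ^ n \<noteq> 1"
begin

lemma powi_eq_1_iff: "q powi i = 1 \<longleftrightarrow> i = 0"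
  using power_int_eq_iff_of_not_root_of_unity[OF q0 q1, of i 0] by simp

lemma powi_double: "q powi (2 * i) = q powi i * q powi i"
  using q0 by (simp only: mult_2 power_int_add simp_thms)

text \<open>Genericity says that no coefficient of \<open>X11\<close> vanishes on the line. One
  parameter may be zero, which gives the modules \<open>M_minus\<close> and \<open>M_plus\<close> as
  degenerate cases.\<close>

lemma iso_full:
  assumes w: "weight \<eta> \<gamma> v" "v \<noteq> \<zero>\<^bsub>V\<^esub>" "\<eta> \<noteq> 0 \<or> \<gamma> \<noteq> 0"
    and generic: "\<And>k::int. \<gamma> * \<eta> \<noteq> - (q powi (2 * k + 1))"
  shows "module_iso (Cq_SL2 q) V (M_full q \<gamma> \<eta>)"
  unfolding M_full_def
proof (rule weight_orbit.iso_typical[where v = v], unfold_locales)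
  show "coeff_full q \<gamma> \<eta> X22 i * coeff_full q \<gamma> \<eta> X11 (i + 1)
      = 1 + q * coeff_full q \<gamma> \<eta> X12 i * coeff_full q \<gamma> \<eta> X21 i" for i
  proof -
    have "2 * (i + 1) - 1 = 2 * i + 1" by simp
    then have "q powi (2 * (i + 1) - 1) = q * q powi i * q powi i"
      using q0 by (simp only: power_int_add powi_double simp_thms) simp
    then show ?thesis by (simp add: coeff_full_def)
  qed
  show "coeff_full q \<gamma> \<eta> X22 i \<noteq> 0 \<and> coeff_full q \<gamma> \<eta> X11 (i + 1) \<noteq> 0" for i
  proof -
    \<comment> \<open>The coefficient vanishes when \<open>\<gamma> * \<eta>\<close> is minus the
      inverse of an odd power of \<open>q\<close>, which is again an odd power, with
      \<open>k = - i - 1\<close>.\<close>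
    have "2 * (i + 1) - 1 = - (2 * (- i - 1) + 1)" by simp
    then have e: "q powi (2 * (i + 1) - 1) = inverse (q powi (2 * (- i - 1) + 1))"
      by (simp only: power_int_minus)
    have "1 + a * inverse b \<noteq> 0" if "a \<noteq> - b" "b \<noteq> 0" for a b :: complex
    proof
      assume "1 + a * inverse b = 0"
      then have "(1 + a * inverse b) * b = 0" by simp
      then have "b + a = 0" using that(2) by (simp add: distrib_right mult.assoc)
      with that(1) show False by (simp add: eq_neg_iff_add_eq_0 add.commute)
    qed
    then have "1 + \<gamma> * \<eta> * q powi (2 * (i + 1) - 1) \<noteq> 0"
      unfolding e using generic[of "- i - 1"] q0 by (metis power_int_not_zero)
    then show ?thesis by (simp add: coeff_full_def)
  qed
qed (use w simple q0 q1 compatible_typical(3)[OF q0] in \<open>auto simp: coeff_full_def\<close>)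

text \<open>Here \<open>v\<close> is the lowest vector \<open>e 0\<close>. The product of the
  eigenvalues determines \<open>\<gamma>\<close> from \<open>\<eta>\<close>, and
  \<open>1 - q powi (2 * (i + 1))\<close> is nonzero for \<open>i \<ge> 0\<close>.\<close>

lemma iso_h:
  assumes w: "weight \<eta> \<gamma> v" "v \<noteq> \<zero>\<^bsub>V\<^esub>" "\<eta> * \<gamma> = - q" "free_gen X11 \<rhd> v = \<zero>\<^bsub>V\<^esub>"
  shows "\<eta> \<noteq> 0" "module_iso (Cq_SL2 q) V (M_h q \<eta>)"
proof -
  show \<eta>: "\<eta> \<noteq> 0" using w(3) q0 by auto
  have \<gamma>: "\<gamma> = - inverse \<eta> * q" using w(3) \<eta> by (simp add: field_simps)
  show "module_iso (Cq_SL2 q) V (M_h q \<eta>)"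
    unfolding M_h_def
  proof (rule weight_orbit.iso_typical[where v = v], unfold_locales)
    show "coeff_h q \<eta> X22 i * coeff_h q \<eta> X11 (i + 1)
        = 1 + q * coeff_h q \<eta> X12 i * coeff_h q \<eta> X21 i" for i
      unfolding coeff_h_def powi_double using \<eta> q0 by (simp add: power_int_add)
    show "coeff_h q \<eta> X22 i \<noteq> 0 \<and> coeff_h q \<eta> X11 (i + 1) \<noteq> 0" if "i \<in> {0..}" for i
      using that powi_eq_1_iff[of "2 * (i + 1)"] by (simp add: coeff_h_def)
  qed (use w simple q0 q1 \<eta> \<gamma> compatible_typical(4)[OF q0] in \<open>auto simp: coeff_h_def power_int_add\<close>)
qed

text \<open>The mirror image, with \<open>v\<close> the highest vector. As in \<open>M_l\<close>,
  the letter \<open>\<gamma>\<close> now denotes the eigenvalue of \<open>X12\<close>, and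
  \<open>\<eta>\<close> that of \<open>X21\<close>.\<close>

lemma iso_l:
  assumes w: "weight \<gamma> \<eta> v" "v \<noteq> \<zero>\<^bsub>V\<^esub>" "\<gamma> * \<eta> = - inverse q" "free_gen X22 \<rhd> v = \<zero>\<^bsub>V\<^esub>"
  shows "\<gamma> \<noteq> 0" "module_iso (Cq_SL2 q) V (M_l q \<gamma>)"
proof -
  show \<gamma>: "\<gamma> \<noteq> 0" using w(3) q0 by auto
  have "\<eta> = inverse \<gamma> * (\<gamma> * \<eta>)" using \<gamma> by simp
  then have \<eta>: "\<eta> = - inverse \<gamma> * inverse q" by (simp add: w(3))
  show "module_iso (Cq_SL2 q) V (M_l q \<gamma>)"
    unfolding M_l_def
  proof (rule weight_orbit.iso_typical[where v = v], unfold_locales)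
    show "coeff_l q \<gamma> X22 i * coeff_l q \<gamma> X11 (i + 1)
        = 1 + q * coeff_l q \<gamma> X12 i * coeff_l q \<gamma> X21 i" for i
      unfolding coeff_l_def powi_double using \<gamma> q0 by (simp add: power_int_diff)
    show "coeff_l q \<gamma> X22 i \<noteq> 0 \<and> coeff_l q \<gamma> X11 (i + 1) \<noteq> 0" if "i + 1 \<in> {..0}" for i
      using that powi_eq_1_iff[of "2 * i"] by (simp add: coeff_l_def)
  qed (use w simple q0 q1 \<gamma> \<eta> compatible_typical(5)[OF q0]
      in \<open>auto simp: coeff_l_def power_int_diff divide_inverse power_int_minus\<close>)
qed

text \<open>\<open>X11\<close> lowers \<open>k\<close> by one and kills no vector unless
  \<open>k = 0\<close>; \<open>X22\<close> raises \<open>k\<close> by one and kills no vector unless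
  \<open>k = - 1\<close>. So positive \<open>k\<close> can be brought down to 0, and
  \<open>k < - 1\<close> up to \<open>- 1\<close>.\<close>

lemma exceptional_weight_shift:
  assumes "weight \<eta> \<gamma> v" "v \<noteq> \<zero>\<^bsub>V\<^esub>" "\<eta> * \<gamma> = - (q powi (2 * k + 1))"
  shows "\<exists>\<eta> \<gamma> w. weight \<eta> \<gamma> w \<and> w \<noteq> \<zero>\<^bsub>V\<^esub> \<and> (\<eta> * \<gamma> = - q \<or> \<eta> * \<gamma> = - inverse q)"
  using assms
proof (induction k arbitrary: \<eta> \<gamma> v rule: int_induct[of _ 0])
  case base
  then show ?case by auto
next
  case (step1 i)
  have "2 * (i + 1) + 1 = (2 * i + 1) + 2" by simp
  then have e: "q powi (2 * (i + 1) + 1) = q powi (2 * i + 1) * q ^ 2"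
    using q0 by (simp only: power_int_add simp_thms) simp
  have "2 * i + 2 = (2 * i + 1) + 1" by simp
  then have e2: "q powi (2 * i + 1) * q = q powi (2 * i + 2)"
    using q0 by (simp only: power_int_add simp_thms) simp
  have "1 + \<eta> * \<gamma> / q = 1 - q powi (2 * i + 2)"
    unfolding step1.prems(3) e e2[symmetric] using q0 by (simp add: power2_eq_square)
  then have "1 + \<eta> * \<gamma> / q \<noteq> 0" using powi_eq_1_iff[of "2 * i + 2"] step1.hyps by auto
  then have "free_gen X11 \<rhd> v \<noteq> \<zero>\<^bsub>V\<^esub>"
    using weight_X22_X11[OF step1.prems(1)] step1.prems(2)
      act_const_eq_zero[OF weight_carrier[OF step1.prems(1)]]
    by fastforce
  moreover have "\<eta> / q * (\<gamma> / q) = - (q powi (2 * i + 1))"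
    using step1.prems(3) q0 unfolding e by (simp add: power2_eq_square field_simps)
  ultimately show ?case using step1.IH weight_X11[OF step1.prems(1) q0] by blast
next
  case (step2 i)
  show ?case
  proof (cases "i = 0")
    \<comment> \<open>This is \<open>k = - 1\<close>, where the product already equals
      \<open>- inverse q\<close>.\<close>
    case True
    with step2.prems show ?thesis by (auto simp: power_int_minus)
  next
    case False
    have "2 * i + 1 = (2 * (i - 1) + 1) + 2" by simp
    then have e: "q powi (2 * i + 1) = q powi (2 * (i - 1) + 1) * q ^ 2"
      using q0 by (simp only: power_int_add simp_thms) simp
    have "2 * i = (2 * (i - 1) + 1) + 1" by simp
    then have e2: "q powi (2 * (i - 1) + 1) * q = q powi (2 * i)"
      using q0 by (simp only: power_int_add simp_thms) simp
    have "1 + q * \<eta> * \<gamma> = 1 - q powi (2 * i)"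
      using step2.prems(3) by (simp add: mult.assoc flip: e2)
    then have "1 + q * \<eta> * \<gamma> \<noteq> 0" using powi_eq_1_iff[of "2 * i"] False by auto
    then have "free_gen X22 \<rhd> v \<noteq> \<zero>\<^bsub>V\<^esub>"
      using weight_X11_X22[OF step2.prems(1)] step2.prems(2)
        act_const_eq_zero[OF weight_carrier[OF step2.prems(1)]]
      by fastforce
    moreover have "q * \<eta> * (q * \<gamma>) = - (q powi (2 * i + 1))"
    proof -
      have "q * \<eta> * (q * \<gamma>) = q * q * (\<eta> * \<gamma>)" by simp
      then show ?thesis unfolding step2.prems(3) e by (simp add: power2_eq_square)
    qed
    ultimately show ?thesis using step2.IH weight_X22[OF step2.prems(1)] by blast
  qed
qed

text \<open>The two target weights are neighbours: between them one of \<open>X22 * X11\<close> and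
  \<open>X11 * X22\<close> is zero. Either the first step already kills \<open>w\<close>, or its
  image is a nonzero vector killed by the other generator, at the end of the opposite half
  line.\<close>

lemma iso_exceptional:
  assumes "weight \<eta> \<gamma> v" "v \<noteq> \<zero>\<^bsub>V\<^esub>" "\<eta> * \<gamma> = - (q powi (2 * k + 1))"
  shows "(\<exists>\<eta>. \<eta> \<noteq> 0 \<and> module_iso (Cq_SL2 q) V (M_h q \<eta>)) \<or>
     (\<exists>\<gamma>. \<gamma> \<noteq> 0 \<and> module_iso (Cq_SL2 q) V (M_l q \<gamma>))"
proof -
  obtain \<eta> \<gamma> w where w: "weight \<eta> \<gamma> w" "w \<noteq> \<zero>\<^bsub>V\<^esub>" "\<eta> * \<gamma> = - q \<or> \<eta> * \<gamma> = - inverse q"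
    using exceptional_weight_shift[OF assms] by blast
  note wc = weight_carrier[OF w(1)]
  from w(3) show ?thesis
  proof
    assume *: "\<eta> * \<gamma> = - q"
    then have "free_gen X22 \<rhd> free_gen X11 \<rhd> w = \<zero>\<^bsub>V\<^esub>"
      using weight_X22_X11[OF w(1)] q0 wc by (simp add: free_const_simps)
    moreover have "\<eta> / q * (\<gamma> / q) = - inverse q" using * q0 by (simp add: field_simps)
    ultimately show ?thesis
      using iso_h[OF w(1,2) *] iso_l[OF weight_X11[OF w(1) q0]] by blast
  next
    assume *: "\<eta> * \<gamma> = - inverse q"
    then have "free_gen X11 \<rhd> free_gen X22 \<rhd> w = \<zero>\<^bsub>V\<^esub>"
      using weight_X11_X22[OF w(1)] q0 wc by (simp add: free_const_simps mult.assoc)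
    moreover have "q * \<eta> * (q * \<gamma>) = - q"
    proof -
      have "q * \<eta> * (q * \<gamma>) = q * q * (\<eta> * \<gamma>)" by simp
      then show ?thesis unfolding * using q0 by simp
    qed
    ultimately show ?thesis
      using iso_l[OF w(1,2) *] iso_h[OF weight_X22[OF w(1)]] by blast
  qed
qed

text \<open>Generators send weight \<open>(0, 0)\<close> to itself, so the joint kernel of
  \<open>X12\<close> and \<open>X21\<close> is invariant. This excludes a zero weight outside type
  \<open>(e,e)\<close>.\<close>

lemma weight_zero_everywhere:
  assumes v: "weight 0 0 v" "v \<noteq> \<zero>\<^bsub>V\<^esub>" and y: "y \<in> carrier V"
  shows "weight 0 0 y"
proof -
  obtain p where p: "y = p \<rhd> v"
    using simple_module_cyclic[OF simple weight_carrier[OF v(1)] v(2) y]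
    by (auto simp: carrier_Cq_SL2 act_def)
  have "p \<rhd> v \<in> {w. weight 0 0 w}"
  proof (rule act_invariant)
    fix g w assume w: "w \<in> {w. weight 0 0 w}"
    then show "free_gen g \<rhd> w \<in> {w. weight 0 0 w}"
      using weight_X11[of 0 0 w] weight_X22[of 0 0 w] weight_const[of 0 0 w 0] q0
      by (cases g) (simp_all add: weight_def)
  qed (use v(1) in \<open>auto simp: weight_def act_add_right free_const_simps act_const_swap\<close>)
  then show ?thesis by (simp add: p)
qed

end

end

section \<open>Assembling the classification\<close>

theorem theorem3p8:
  fixes q :: complex and V :: "(free set, 'v) module"
  assumes q_nonzero: "q \<noteq> 0"
    and q_not_root_of_unity: "\<forall>n::nat. n > 0 \<longrightarrow> q ^ n \<noteq> 1"
    and simple: "simple_module (Cq_SL2 q) V"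
    and not_type_ee:
      "\<not> ((\<forall>v\<in>carrier V. Cq_gen q X12 \<odot>\<^bsub>V\<^esub> v = \<zero>\<^bsub>V\<^esub>) \<and>
          (\<forall>v\<in>carrier V. Cq_gen q X21 \<odot>\<^bsub>V\<^esub> v = \<zero>\<^bsub>V\<^esub>))"
    and semisimple:
      "semisimple_module ((Cq_SL2 q)\<lparr>carrier := Cq_subalgebra q {X12, X21}\<rparr>) V"
  shows
    "(\<exists>\<gamma>. \<gamma> \<noteq> 0 \<and> module_iso (Cq_SL2 q) V (M_minus q \<gamma>)) \<or>
     (\<exists>\<eta>. \<eta> \<noteq> 0 \<and> module_iso (Cq_SL2 q) V (M_plus q \<eta>)) \<or>
     (\<exists>\<gamma> \<eta>. \<gamma> \<noteq> 0 \<and> \<eta> \<noteq> 0 \<and> (\<forall>k::int. \<gamma> * \<eta> \<noteq> - (q powi (2 * k + 1))) \<and>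
        module_iso (Cq_SL2 q) V (M_full q \<gamma> \<eta>)) \<or>
     (\<exists>\<eta>. \<eta> \<noteq> 0 \<and> module_iso (Cq_SL2 q) V (M_h q \<eta>)) \<or>
     (\<exists>\<gamma>. \<gamma> \<noteq> 0 \<and> module_iso (Cq_SL2 q) V (M_l q \<gamma>))"
proof -
  interpret Cq_module q V
    by (rule Cq_module.intro) (use simple in \<open>simp add: simple_module_def\<close>)
  note hyps = simple q_nonzero q_not_root_of_unity
  obtain S where "simple_submodule S ((Cq_SL2 q)\<lparr>carrier := Cq_subalgebra q {X12, X21}\<rparr>) V"
    using semisimple_module_obtains_simple[OF semisimple] simple by (auto simp: simple_module_def)
  then obtain v \<eta> \<gamma> where v: "weight \<eta> \<gamma> v" "v \<noteq> \<zero>\<^bsub>V\<^esub>" by (rule simple_submodule_weight)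
  have nz: "\<eta> \<noteq> 0 \<or> \<gamma> \<noteq> 0"
  proof (rule ccontr)
    assume "\<not> ?thesis"
    with v have "weight 0 0 y" if "y \<in> carrier V" for y
      using weight_zero_everywhere[OF hyps] that by simp
    then have "\<forall>y\<in>carrier V. free_gen X12 \<rhd> y = \<zero>\<^bsub>V\<^esub> \<and> free_gen X21 \<rhd> y = \<zero>\<^bsub>V\<^esub>"
      by (simp add: weight_def free_const_simps)
    with not_type_ee show False by (simp add: act_def Cq_gen_def)
  qed
  show ?thesis
  \<comment> \<open>Moving by \<open>i\<close> along the orbit multiplies
    \<open>\<eta> * \<gamma>\<close> by \<open>q powi (2 * i)\<close>, so these are the products for
    which the scalar of \<open>X11 * X22\<close> vanishes somewhere.\<close>
  proof (cases "\<exists>k::int. \<eta> * \<gamma> = - (q powi (2 * k + 1))")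
    case True
    then show ?thesis using iso_exceptional[OF hyps v] by blast
  next
    case False
    then have generic: "\<gamma> * \<eta> \<noteq> - (q powi (2 * k + 1))" for k :: int
      by (metis mult.commute)
    have full: "module_iso (Cq_SL2 q) V (M_full q \<gamma> \<eta>)"
      by (rule iso_full[OF hyps v nz generic])
    \<comment> \<open>Setting one parameter to zero turns the full coefficients into those of
      \<open>M_minus\<close> or \<open>M_plus\<close>.\<close>
    have minus: "coeff_full q \<gamma> 0 = coeff_minus q \<gamma>"
      by (intro ext) (simp add: coeff_full_def coeff_minus_def split: gen.split)
    have plus: "coeff_full q 0 \<eta> = coeff_plus q \<eta>"
      by (intro ext) (simp add: coeff_full_def coeff_plus_def split: gen.split)
    consider "\<eta> = 0" "\<gamma> \<noteq> 0" | "\<gamma> = 0" "\<eta> \<noteq> 0" | "\<gamma> \<noteq> 0" "\<eta> \<noteq> 0" using nz by blast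
    then show ?thesis
    proof cases
      case 1
      with full have "module_iso (Cq_SL2 q) V (M_minus q \<gamma>)"
        by (simp add: M_full_def M_minus_def minus)
      with 1 show ?thesis by blast
    next
      case 2
      with full have "module_iso (Cq_SL2 q) V (M_plus q \<eta>)"
        by (simp add: M_full_def M_plus_def plus)
      with 2 show ?thesis by blast
    next
      case 3
      with full generic show ?thesis by blast
    qed
  qed
qed

end
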